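(* Let $\mathcal{L}$ be a countable relational language and let $\boldsymbol{M}$ be a Fraïssé $\mathcal{L}$-structure with domain $\mathbb{N}$ that has no algebraicity, and let $\mathcal{K}=\mathrm{Age}(\boldsymbol{M})$. (1) If $\mathcal{K}$ splits, then the set of $A\subseteq\mathbb{N}$ such that $\boldsymbol{A}=\langle A\rangle_{\boldsymbol{M}}$ is a strongly non-global substructure is comeager in $2^{\mathbb{N}}$, and the set of pairs $(A,B)$ such that $\boldsymbol{A},\boldsymbol{B}$ is a strongly non-global pair is comeager in $2^{\mathbb{N}}\times 2^{\mathbb{N}}$. (2) If $\mathcal{K}$ does not split, then the set of $A\subseteq\mathbb{N}$ such that $\boldsymbol{A}$ is a global substructure is comeager in $2^{\mathbb{N}}$, and the set of pairs $(A,B)$ such that $\boldsymbol{A},\boldsymbol{B}$ is a global pair is comeager in $2^{\mathbb{N}}\times 2^{\mathbb{N}}$.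
   Context: A Fraïssé structure is a countably infinite structure $\boldsymbol{M}$ in a countable relational language which is ultrahomogeneous (every isomorphism between finite substructures extends to an automorphism of $\boldsymbol{M}$); $\mathrm{Age}(\boldsymbol{M})$ is the class of finite structures embeddable in $\boldsymbol{M}$ (a Fraïssé class). $\boldsymbol{M}$ has no algebraicity if the pointwise stabilizer in $\mathrm{Aut}(\boldsymbol{M})$ of any finite tuple has no finite orbits on $M$ (equivalently, the age has the strong amalgamation property). Subsets $A\subseteq M=\mathbb{N}$ correspond to substructures $\boldsymbol{A}=\langle A\rangle_{\boldsymbol{M}}$ and are identified with points of the Cantor space $2^{\mathbb{N}}$. A Fraïssé class $\mathcal{K}$ splits if there is $\boldsymbol{C}\in\mathcal{K}$ such that for every $\boldsymbol{D}\in\mathcal{K}$ and every embedding $i:\boldsymbol{C}\to\boldsymbol{D}$ there are $\boldsymbol{D}_1,\boldsymbol{D}_2\in\mathcal{K}$, embeddings $j_1:\boldsymbol{D}\to\boldsymbol{D}_1$, $j_2:\boldsymbol{D}\to\boldsymbol{D}_2$ and a bijection $f:D_1\to D_2$ with $f\circ j_1=j_2$, such that $f$ restricted to $D_1\setminus j_1(i(C))$ is an isomorphism between the induced substructures $\langle D_1\setminus j_1(i(C))\rangle_{\boldsymbol{D}_1}$ and $\langle D_2\setminus j_2(i(C))\rangle_{\boldsymbol{D}_2}$, but $f$ is not an isomorphism between $\boldsymbol{D}_1$ and $\boldsymbol{D}_2$. For substructures $\boldsymbol{A},\boldsymbol{B}$ of $\boldsymbol{M}$, $\mathrm{Iso}(\boldsymbol{A},\boldsymbol{B})$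 is the space of isomorphisms $\boldsymbol{A}\to\boldsymbol{B}$ with the pointwise convergence topology, $\mathrm{Iso}(\boldsymbol{A})=\mathrm{Iso}(\boldsymbol{A},\boldsymbol{A})$, and $\mathcal{E}(\boldsymbol{A},\boldsymbol{B})$ (resp. $\mathcal{E}(\boldsymbol{A})$) is the set of those isomorphisms that extend to an automorphism of $\boldsymbol{M}$. $\boldsymbol{A}$ is global if $\mathcal{E}(\boldsymbol{A})=\mathrm{Iso}(\boldsymbol{A})$ and strongly non-global if $\mathcal{E}(\boldsymbol{A})$ is meager in $\mathrm{Iso}(\boldsymbol{A})$; the pair $\boldsymbol{A},\boldsymbol{B}$ is global if $\mathcal{E}(\boldsymbol{A},\boldsymbol{B})=\mathrm{Iso}(\boldsymbol{A},\boldsymbol{B})$ and strongly non-global if $\mathcal{E}(\boldsymbol{A},\boldsymbol{B})$ is meager in $\mathrm{Iso}(\boldsymbol{A},\boldsymbol{B})$. *)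

theory Defs
  imports "HOL-Analysis.Analysis"
begin

section \<open>Relational languages, structures, embeddings\<close>

record 'r lang =
  symbols :: "'r set"
  arity :: "'r \<Rightarrow> nat"

text \<open>Only the values of \<open>interp\<close> at symbols of the language and at tuples of the right length
  with entries in \<open>carr\<close> are ever inspected; all other values are irrelevant, and structures are
  never compared by equality.\<close>

record ('r, 'a) struct =
  carr :: "'a set"
  interp :: "'r \<Rightarrow> 'a list \<Rightarrow> bool"

definition embedding :: "'r lang \<Rightarrow> ('r, 'a) struct \<Rightarrow> ('r, 'b) struct \<Rightarrow> ('a \<Rightarrow> 'b) \<Rightarrow> bool" where
  "embedding L A B f \<longleftrightarrow>
     f \<in> carr A \<rightarrow> carr B \<and> inj_on f (carr A) \<and>
     (\<forall>R\<in>symbols L. \<forall>xs. length xs = arity L R \<and> set xs \<subseteq> carr A \<longrightarrow>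
        (interp A R xs \<longleftrightarrow> interp B R (map f xs)))"

definition isomorphism :: "'r lang \<Rightarrow> ('r, 'a) struct \<Rightarrow> ('r, 'b) struct \<Rightarrow> ('a \<Rightarrow> 'b) \<Rightarrow> bool" where
  "isomorphism L A B f \<longleftrightarrow> embedding L A B f \<and> f ` carr A = carr B"

definition substr :: "('r, 'a) struct \<Rightarrow> 'a set \<Rightarrow> ('r, 'a) struct" where
  "substr M A = \<lparr>carr = A, interp = (\<lambda>R xs. interp M R xs \<and> set xs \<subseteq> A)\<rparr>"

text \<open>Isomorphisms as a set of functions: values outside the domain are fixed (to \<open>undefined\<close>),
  so that isomorphisms are determined by their values on the domain.\<close>

definition Iso :: "'r lang \<Rightarrow> ('r, 'a) struct \<Rightarrow> ('r, 'b) struct \<Rightarrow> ('a \<Rightarrow> 'b) set" where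
  "Iso L A B = {f \<in> extensional (carr A). isomorphism L A B f}"

definition Aut :: "'r lang \<Rightarrow> ('r, 'a) struct \<Rightarrow> ('a \<Rightarrow> 'a) set" where
  "Aut L M = Iso L M M"


section \<open>Fraisse structures, algebraicity, age, splitting\<close>

definition ultrahomogeneous :: "'r lang \<Rightarrow> ('r, 'a) struct \<Rightarrow> bool" where
  "ultrahomogeneous L M \<longleftrightarrow>
     (\<forall>A B f. finite A \<and> finite B \<and> A \<subseteq> carr M \<and> B \<subseteq> carr M \<and>
        isomorphism L (substr M A) (substr M B) f \<longrightarrow>
        (\<exists>g\<in>Aut L M. \<forall>x\<in>A. g x = f x))"

definition fraisse_structure :: "'r lang \<Rightarrow> ('r, 'a) struct \<Rightarrow> bool" where
  "fraisse_structure L M \<longleftrightarrow>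
     countable (symbols L) \<and> countable (carr M) \<and> infinite (carr M) \<and> ultrahomogeneous L M"

definition pointwise_stabilizer :: "'r lang \<Rightarrow> ('r, 'a) struct \<Rightarrow> 'a list \<Rightarrow> ('a \<Rightarrow> 'a) set" where
  "pointwise_stabilizer L M xs = {g \<in> Aut L M. \<forall>x\<in>set xs. g x = x}"

text \<open>The entries of the tuple themselves are of course fixed by its stabilizer, so ``no finite
  orbits'' refers to the remaining points.\<close>

definition no_algebraicity :: "'r lang \<Rightarrow> ('r, 'a) struct \<Rightarrow> bool" where
  "no_algebraicity L M \<longleftrightarrow>
     (\<forall>xs. set xs \<subseteq> carr M \<longrightarrow>
        (\<forall>a \<in> carr M - set xs. infinite ((\<lambda>g. g a) ` pointwise_stabilizer L M xs)))"

text \<open>Every finite structure is isomorphic to one whose domain consists of natural numbers, so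
  isomorphism-closed classes of finite structures are represented as sets of structures over
  \<open>nat\<close>.\<close>

definition Age :: "'r lang \<Rightarrow> ('r, 'a) struct \<Rightarrow> ('r, nat) struct set" where
  "Age L M = {D. finite (carr D) \<and> (\<exists>e. embedding L D M e)}"

definition splits :: "'r lang \<Rightarrow> ('r, nat) struct set \<Rightarrow> bool" where
  "splits L K \<longleftrightarrow>
     (\<exists>C\<in>K. \<forall>D\<in>K. \<forall>i. embedding L C D i \<longrightarrow>
        (\<exists>D1\<in>K. \<exists>D2\<in>K. \<exists>j1 j2 f.
           embedding L D D1 j1 \<and> embedding L D D2 j2 \<and>
           bij_betw f (carr D1) (carr D2) \<and> (\<forall>x\<in>carr D. f (j1 x) = j2 x) \<and>
           isomorphism L (substr D1 (carr D1 - j1 ` i ` carr C))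
                         (substr D2 (carr D2 - j2 ` i ` carr C)) f \<and>
           \<not> isomorphism L D1 D2 f))"


section \<open>Meager and comeager sets\<close>

definition nowhere_dense_in :: "'a topology \<Rightarrow> 'a set \<Rightarrow> bool" where
  "nowhere_dense_in X N \<longleftrightarrow> N \<subseteq> topspace X \<and> X interior_of (X closure_of N) = {}"

definition meager_in :: "'a topology \<Rightarrow> 'a set \<Rightarrow> bool" where
  "meager_in X S \<longleftrightarrow> (\<exists>\<N>. countable \<N> \<and> (\<forall>N\<in>\<N>. nowhere_dense_in X N) \<and> S = \<Union>\<N>)"

definition comeager_in :: "'a topology \<Rightarrow> 'a set \<Rightarrow> bool" where
  "comeager_in X S \<longleftrightarrow> S \<subseteq> topspace X \<and> meager_in X (topspace X - S)"

text \<open>The Cantor space as a topology on the subsets of the natural numbers, identified with their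
  characteristic functions.\<close>

definition cantor_space :: "nat set topology" where
  "cantor_space =
     pullback_topology UNIV (\<lambda>A n. n \<in> A)
       (product_topology (\<lambda>n::nat. discrete_topology (UNIV :: bool set)) UNIV)"

lemma topspace_cantor_space [simp]: "topspace cantor_space = UNIV"
  by (simp add: cantor_space_def topspace_pullback_topology)


section \<open>Global and strongly non-global substructures\<close>

text \<open>Pointwise convergence: the subspace topology from the product of discrete spaces.\<close>

definition Iso_space :: "'r lang \<Rightarrow> ('r, 'a) struct \<Rightarrow> ('r, 'b) struct \<Rightarrow> ('a \<Rightarrow> 'b) topology" where
  "Iso_space L A B =
     subtopology (product_topology (\<lambda>_. discrete_topology (carr B)) (carr A)) (Iso L A B)"

lemma topspace_Iso_space [simp]: "topspace (Iso_space L A B) = Iso L A B"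
  by (auto simp: Iso_space_def Iso_def isomorphism_def embedding_def PiE_def)

definition extendable_isos :: "'r lang \<Rightarrow> ('r, 'a) struct \<Rightarrow> 'a set \<Rightarrow> 'a set \<Rightarrow> ('a \<Rightarrow> 'a) set" where
  "extendable_isos L M A B =
     {f \<in> Iso L (substr M A) (substr M B). \<exists>g\<in>Aut L M. \<forall>x\<in>A. g x = f x}"

definition global_pair :: "'r lang \<Rightarrow> ('r, 'a) struct \<Rightarrow> 'a set \<Rightarrow> 'a set \<Rightarrow> bool" where
  "global_pair L M A B \<longleftrightarrow> extendable_isos L M A B = Iso L (substr M A) (substr M B)"

definition strongly_nonglobal_pair :: "'r lang \<Rightarrow> ('r, 'a) struct \<Rightarrow> 'a set \<Rightarrow> 'a set \<Rightarrow> bool" where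
  "strongly_nonglobal_pair L M A B \<longleftrightarrow>
     meager_in (Iso_space L (substr M A) (substr M B)) (extendable_isos L M A B)"

definition global_substr :: "'r lang \<Rightarrow> ('r, 'a) struct \<Rightarrow> 'a set \<Rightarrow> bool" where
  "global_substr L M A \<longleftrightarrow> global_pair L M A A"

definition strongly_nonglobal_substr :: "'r lang \<Rightarrow> ('r, 'a) struct \<Rightarrow> 'a set \<Rightarrow> bool" where
  "strongly_nonglobal_substr L M A \<longleftrightarrow> strongly_nonglobal_pair L M A A"

end

theory Submission
  imports Defs
begin

text \<open>Call \<open>A\<close> generic if, for every finite \<open>D\<close> and \<open>x \<notin> D\<close>, the orbit of \<open>x\<close> over \<open>D\<close> meets both
  \<open>A\<close> and its complement. Without algebraicity these orbits are infinite, so generic sets are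
  comeager; it remains to treat a pair of generic sets \<open>A\<close>, \<open>B\<close>. By back and forth, every finite
  partial isomorphism from \<open>A\<close> to \<open>B\<close> extends to an isomorphism.

  If the age does not split, every finite \<open>C\<close> disjoint from \<open>A\<close> has a finite \<open>E \<subseteq> A\<close> such that the
  structure on \<open>A \<union> C\<close> is determined by those on \<open>A\<close> and on \<open>C \<union> E\<close>. Hence an isomorphism
  \<open>A \<rightarrow> B\<close>, already extended by finitely many points outside \<open>A\<close>, can be extended by one more,
  sent outside \<open>B\<close>; back and forth yields an automorphism.

  If the age splits at \<open>C\<close>, choose a copy of \<open>C\<close> in the complement of \<open>A\<close>. For each of the countably
  many maps \<open>r\<close> on \<open>C\<close>, the isomorphisms compatible with \<open>r\<close> are nowhere dense: a finite
  part of such an isomorphism can be continued inside \<open>A\<close> and \<open>B\<close> according to the two structures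
  given by splitting, which makes it incompatible with \<open>r\<close>.\<close>

section \<open>Partial isomorphisms\<close>

definition graph_on :: "('a \<Rightarrow> 'b) \<Rightarrow> 'a set \<Rightarrow> ('a \<times> 'b) set" where
  "graph_on f A = (\<lambda>x. (x, f x)) ` A"

lemma mem_graph_on [simp]: "(x, y) \<in> graph_on f A \<longleftrightarrow> x \<in> A \<and> y = f x"
  by (auto simp: graph_on_def)

lemma Domain_graph_on [simp]: "Domain (graph_on f A) = A"
  by (auto simp: Domain_iff)

lemma Range_graph_on [simp]: "Range (graph_on f A) = f ` A"
  by (auto simp: Range_iff)

lemma finite_graph_on [simp]: "finite A \<Longrightarrow> finite (graph_on f A)"
  by (simp add: graph_on_def)

text \<open>Relations instead of functions: converses and compositions of partial isomorphisms are then
  again partial isomorphisms, without any bookkeeping of domains.\<close>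

definition partial_iso ::
  "'r lang \<Rightarrow> ('r, 'a) struct \<Rightarrow> ('r, 'b) struct \<Rightarrow> ('a \<times> 'b) set \<Rightarrow> bool" where
  "partial_iso L S T R \<longleftrightarrow> single_valued R \<and> single_valued (R\<inverse>) \<and>
     (\<forall>r\<in>symbols L. \<forall>xs ys. length xs = arity L r \<and> list_all2 (\<lambda>x y. (x, y) \<in> R) xs ys \<longrightarrow>
        (interp S r xs \<longleftrightarrow> interp T r ys))"

lemma partial_isoD1:
  "partial_iso L S T R \<Longrightarrow> (x, y) \<in> R \<Longrightarrow> (x, z) \<in> R \<Longrightarrow> y = z"
  by (auto simp: partial_iso_def dest: single_valuedD)

lemma partial_isoD2:
  "partial_iso L S T R \<Longrightarrow> (x, z) \<in> R \<Longrightarrow> (y, z) \<in> R \<Longrightarrow> x = y"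
  by (auto simp: partial_iso_def single_valued_def)

lemma partial_iso_subset:
  assumes "partial_iso L S T R" "Q \<subseteq> R"
  shows "partial_iso L S T Q"
proof -
  have "list_all2 (\<lambda>x y. (x, y) \<in> R) xs ys" if "list_all2 (\<lambda>x y. (x, y) \<in> Q) xs ys" for xs ys
    using that assms(2) by (auto elim!: list_all2_mono)
  moreover have "single_valued Q" "single_valued (Q\<inverse>)"
    using partial_isoD1[OF assms(1)] partial_isoD2[OF assms(1)] assms(2)
    unfolding single_valued_def by blast+
  ultimately show ?thesis
    using assms(1) by (auto simp: partial_iso_def)
qed

lemma partial_iso_converse:
  assumes "partial_iso L S T R"
  shows "partial_iso L T S (R\<inverse>)"
proof -
  have "list_all2 (\<lambda>x y. (x, y) \<in> R) ys xs \<and> length ys = length xs"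
    if "list_all2 (\<lambda>x y. (x, y) \<in> R\<inverse>) xs ys" for xs ys
    using that by (auto simp: list_all2_conv_all_nth)
  then show ?thesis
    using assms unfolding partial_iso_def converse_converse by metis
qed

lemma partial_iso_converse_iff: "partial_iso L T S (R\<inverse>) \<longleftrightarrow> partial_iso L S T R"
  using partial_iso_converse[of L S T R] partial_iso_converse[of L T S "R\<inverse>"] by auto

lemma partial_iso_comp:
  assumes "partial_iso L S T P" "partial_iso L T U Q"
  shows "partial_iso L S U (P O Q)"
proof -
  have "\<exists>ys. list_all2 (\<lambda>x y. (x, y) \<in> P) xs ys \<and> list_all2 (\<lambda>x y. (x, y) \<in> Q) ys zs"
    if "list_all2 (\<lambda>x y. (x, y) \<in> P O Q) xs zs" for xs zs
  proof -
    have "(\<lambda>x y. (x, y) \<in> P O Q) = (\<lambda>x y. (x, y) \<in> P) OO (\<lambda>x y. (x, y) \<in> Q)"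
      by (auto simp: fun_eq_iff)
    then show ?thesis using that by (auto simp: list.rel_compp)
  qed
  moreover have "single_valued (P O Q)" "single_valued ((P O Q)\<inverse>)"
    using assms by (auto simp: partial_iso_def converse_relcomp intro: single_valued_relcomp)
  ultimately show ?thesis
    using assms unfolding partial_iso_def by (metis list_all2_lengthD)
qed

text \<open>Each way of failing to be a partial isomorphism involves only two pairs or one tuple.
  This serves limits of chains, and it yields a finite obstruction whenever a relation is not a
  partial isomorphism.\<close>

lemma partial_iso_finite_character:
  assumes "\<And>F. finite F \<Longrightarrow> F \<subseteq> R \<Longrightarrow> partial_iso L S T F"
  shows "partial_iso L S T R"
proof -
  have "y = z" if "(x, y) \<in> R" "(x, z) \<in> R" for x y z
    using partial_isoD1[OF assms[of "{(x, y), (x, z)}"]] that by auto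
  moreover have "x = y" if "(x, z) \<in> R" "(y, z) \<in> R" for x y z
    using partial_isoD2[OF assms[of "{(x, z), (y, z)}"]] that by auto
  moreover have "interp S r xs \<longleftrightarrow> interp T r ys"
    if "r \<in> symbols L" "length xs = arity L r" "list_all2 (\<lambda>x y. (x, y) \<in> R) xs ys" for r xs ys
  proof -
    have "set (zip xs ys) \<subseteq> R" "list_all2 (\<lambda>x y. (x, y) \<in> set (zip xs ys)) xs ys"
      using that(3) by (auto simp: list_all2_iff)
    with assms[of "set (zip xs ys)"] that show ?thesis
      by (auto simp: partial_iso_def)
  qed
  ultimately show ?thesis
    by (auto simp: partial_iso_def single_valued_def)
qed

lemma single_valued_graph_ex:
  assumes "single_valued R" "single_valued (R\<inverse>)"
  obtains f where "R = graph_on f (Domain R)" "inj_on f (Domain R)"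
proof
  let ?f = "\<lambda>x. THE y. (x, y) \<in> R"
  have f: "?f x = y" if "(x, y) \<in> R" for x y
    using that single_valuedD[OF assms(1)] by blast
  then show "R = graph_on ?f (Domain R)" by auto
  show "inj_on ?f (Domain R)"
    by (rule inj_onI) (metis DomainE assms(2) converseI f single_valuedD)
qed

lemma partial_iso_graph_ex:
  assumes "partial_iso L S T R"
  obtains f where "R = graph_on f (Domain R)" "inj_on f (Domain R)"
  using single_valued_graph_ex assms unfolding partial_iso_def by metis

lemma list_all2_graph_on:
  "list_all2 (\<lambda>x y. (x, y) \<in> graph_on f A) xs ys \<longleftrightarrow> set xs \<subseteq> A \<and> ys = map f xs"
  by (induction xs arbitrary: ys) (auto simp: list_all2_Cons1)

lemma partial_iso_graph_on:
  "partial_iso L S T (graph_on f A) \<longleftrightarrow> inj_on f A \<and>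
     (\<forall>r\<in>symbols L. \<forall>xs. length xs = arity L r \<and> set xs \<subseteq> A \<longrightarrow>
        (interp S r xs \<longleftrightarrow> interp T r (map f xs)))"
  unfolding partial_iso_def list_all2_graph_on
  by (auto simp: single_valued_def inj_on_def)

section \<open>Embeddings, isomorphisms and induced substructures\<close>

lemma embedding_iff_partial_iso:
  "embedding L S T f \<longleftrightarrow> f ` carr S \<subseteq> carr T \<and> partial_iso L S T (graph_on f (carr S))"
  by (auto simp: embedding_def partial_iso_graph_on)

lemma isomorphism_iff_partial_iso:
  "isomorphism L S T f \<longleftrightarrow> f ` carr S = carr T \<and> partial_iso L S T (graph_on f (carr S))"
  by (auto simp: isomorphism_def embedding_iff_partial_iso)

lemma carr_substr [simp]: "carr (substr S A) = A"
  by (simp add: substr_def)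

text \<open>\<open>substr\<close> makes relations false on tuples leaving the carrier, but tuples
  related through \<open>R\<close> stay in \<open>A\<close> and in \<open>B\<close>.\<close>

lemma partial_iso_substr:
  assumes "R \<subseteq> A \<times> B"
  shows "partial_iso L (substr S A) (substr T B) R \<longleftrightarrow> partial_iso L S T R"
proof -
  have "set xs \<subseteq> A \<and> set ys \<subseteq> B" if "list_all2 (\<lambda>x y. (x, y) \<in> R) xs ys" for xs ys
    using that assms by (induction rule: list_all2_induct) auto
  then have "(interp (substr S A) r xs \<longleftrightarrow> interp (substr T B) r ys) \<longleftrightarrow>
      (interp S r xs \<longleftrightarrow> interp T r ys)" if "list_all2 (\<lambda>x y. (x, y) \<in> R) xs ys" for r xs ys
    using that by (auto simp: substr_def)
  then show ?thesis
    unfolding partial_iso_def by blast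
qed

lemma partial_iso_substr_left:
  assumes "Domain R \<subseteq> A"
  shows "partial_iso L (substr S A) T R \<longleftrightarrow> partial_iso L S T R"
proof -
  have "set xs \<subseteq> A" if "list_all2 (\<lambda>x y. (x, y) \<in> R) xs ys" for xs ys
    using that assms by (induction rule: list_all2_induct) auto
  then have "interp (substr S A) r xs = interp S r xs"
    if "list_all2 (\<lambda>x y. (x, y) \<in> R) xs ys" for r xs ys
    using that by (auto simp: substr_def)
  then show ?thesis
    unfolding partial_iso_def by blast
qed

lemma partial_iso_substr_right:
  assumes "Range R \<subseteq> B"
  shows "partial_iso L S (substr T B) R \<longleftrightarrow> partial_iso L S T R"
  using partial_iso_substr_left[of "R\<inverse>" B L T S] assms by (simp add: partial_iso_converse_iff)

lemma isomorphism_substr_iff: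
  "isomorphism L (substr S A) (substr T B) f \<longleftrightarrow> f ` A = B \<and> partial_iso L S T (graph_on f A)"
proof -
  have "f ` A = B \<Longrightarrow> graph_on f A \<subseteq> A \<times> B" by auto
  then show ?thesis
    by (auto simp: isomorphism_iff_partial_iso partial_iso_substr)
qed

lemma Iso_substr_iff:
  "f \<in> Iso L (substr S A) (substr T B) \<longleftrightarrow>
     f \<in> extensional A \<and> f ` A = B \<and> partial_iso L S T (graph_on f A)"
  by (simp add: Iso_def isomorphism_substr_iff)

lemma partial_iso_imp_Iso_substr:
  assumes "partial_iso L S T R" "Domain R = A" "Range R = B"
  obtains f where "f \<in> Iso L (substr S A) (substr T B)" "R = graph_on f A"
proof -
  obtain f where f: "R = graph_on f A"
    using partial_iso_graph_ex[OF assms(1)] assms(2) by metis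
  \<comment> \<open>\<open>Iso\<close> contains only extensional functions, hence the
    restriction.\<close>
  have "graph_on (restrict f A) A = graph_on f A" by auto
  moreover have "restrict f A ` A = B"
    using assms(3) f by auto
  ultimately show thesis
    using that[of "restrict f A"] f assms(1) by (simp add: Iso_substr_iff)
qed

section \<open>Back and forth\<close>

text \<open>Both sides live on the natural numbers, so stage \<open>n\<close> handles the number
  \<open>n\<close> in \<open>X\<close> and in \<open>Y\<close>. The invariant \<open>P\<close> is
  abstract because it is used both for finite relations and for finite extensions of an infinite
  isomorphism.\<close>

lemma partial_iso_back_and_forth:
  fixes P :: "(nat \<times> nat) set \<Rightarrow> bool"
  assumes init: "P R0"
    and piso: "\<And>R. P R \<Longrightarrow> partial_iso L S T R"
    and bound: "\<And>R. P R \<Longrightarrow> R \<subseteq> Z"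
    and step_dom: "\<And>R x. P R \<Longrightarrow> x \<in> X \<Longrightarrow> \<exists>R'. R \<subseteq> R' \<and> P R' \<and> x \<in> Domain R'"
    and step_rng: "\<And>R y. P R \<Longrightarrow> y \<in> Y \<Longrightarrow> \<exists>R'. R \<subseteq> R' \<and> P R' \<and> y \<in> Range R'"
  obtains R where "R0 \<subseteq> R" "partial_iso L S T R" "R \<subseteq> Z" "X \<subseteq> Domain R" "Y \<subseteq> Range R"
proof -
  have "\<exists>R'. P R' \<and> R \<subseteq> R' \<and> (n \<in> X \<longrightarrow> n \<in> Domain R') \<and> (n \<in> Y \<longrightarrow> n \<in> Range R')"
    if "P R" for R n
  proof -
    from that obtain R1 where R1: "R \<subseteq> R1" "P R1" "n \<in> X \<longrightarrow> n \<in> Domain R1"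
      using step_dom[of R n] by blast
    from this(2) obtain R2 where "R1 \<subseteq> R2" "P R2" "n \<in> Y \<longrightarrow> n \<in> Range R2"
      using step_rng[of R1 n] by blast
    with R1 show ?thesis by (meson Domain_mono in_mono subset_trans)
  qed
  \<comment> \<open>The clause \<open>n = 0 \<longrightarrow> R = R0\<close> in the choice predicate
    makes the chain start at \<open>R0\<close>.\<close>
  then obtain R where R: "\<And>n. P (R n)" "R 0 = R0" "\<And>n. R n \<subseteq> R (Suc n)"
    "\<And>n. n \<in> X \<Longrightarrow> n \<in> Domain (R (Suc n))" "\<And>n. n \<in> Y \<Longrightarrow> n \<in> Range (R (Suc n))"
    using dependent_nat_choice[of "\<lambda>n R. P R \<and> (n = 0 \<longrightarrow> R = R0)"
        "\<lambda>n R R'. R \<subseteq> R' \<and> (n \<in> X \<longrightarrow> n \<in> Domain R') \<and> (n \<in> Y \<longrightarrow> n \<in> Range R')"] init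
    by (metis nat.distinct(1))
  have "partial_iso L S T (\<Union>n. R n)"
  proof (rule partial_iso_finite_character)
    fix F assume F: "finite F" "F \<subseteq> (\<Union>n. R n)"
    have mono: "R m \<subseteq> R n" if "m \<le> n" for m n
      using lift_Suc_mono_le[of R, OF R(3) that] .
    from F have "\<exists>n. F \<subseteq> R n"
    proof (induction rule: finite_induct)
      case (insert z F)
      then obtain m n where "F \<subseteq> R m" "z \<in> R n" by blast
      then have "insert z F \<subseteq> R (max m n)"
        using mono[of m "max m n"] mono[of n "max m n"] by auto
      then show ?case ..
    qed auto
    then show "partial_iso L S T F"
      using piso[OF R(1)] partial_iso_subset by blast
  qed
  moreover have "R0 \<subseteq> (\<Union>n. R n)" using R(2) by blast
  moreover have "(\<Union>n. R n) \<subseteq> Z" using bound R(1) by blast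
  moreover have "X \<subseteq> Domain (\<Union>n. R n)" "Y \<subseteq> Range (\<Union>n. R n)"
    using R(4,5) by blast+
  ultimately show thesis using that by blast
qed


section \<open>Generic sets\<close>

locale fraisse_no_algebraicity =
  fixes L :: "'r lang" and M :: "('r, nat) struct"
  assumes fraisse: "fraisse_structure L M"
    and carr_M [simp]: "carr M = UNIV"
    and no_alg: "no_algebraicity L M"
begin

abbreviation PI :: "(nat \<times> nat) set \<Rightarrow> bool" where
  "PI \<equiv> partial_iso L M M"

section \<open>Ultrahomogeneity and orbits over finite sets\<close>

lemma self_isomorphism_iff:
  "isomorphism L M M g \<longleftrightarrow> surj g \<and> PI (graph_on g UNIV)"
  by (simp add: isomorphism_iff_partial_iso)

text \<open>This is ultrahomogeneity, with automorphisms written as surjections whose graph is a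
  partial isomorphism.\<close>

lemma finite_PI_extends:
  assumes "finite R" "PI R"
  obtains g where "surj g" "PI (graph_on g UNIV)" "R \<subseteq> graph_on g UNIV"
proof -
  obtain f D where f: "R = graph_on f D" and D: "D = Domain R"
    using partial_iso_graph_ex[OF assms(2)] by blast
  have "isomorphism L (substr M D) (substr M (f ` D)) f"
    using f assms(2) by (simp add: isomorphism_substr_iff)
  moreover have "finite D" using assms(1) by (simp add: D finite_Domain)
  ultimately have "\<exists>g\<in>Aut L M. \<forall>x\<in>D. g x = f x"
    using fraisse unfolding fraisse_structure_def ultrahomogeneous_def
    by (metis carr_M finite_imageI subset_UNIV)
  then obtain g where g: "g \<in> Aut L M" "\<forall>x\<in>D. g x = f x" by blast
  from g(2) have "graph_on f D \<subseteq> graph_on g UNIV" by auto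
  with g(1) show thesis
    using that[of g] f by (simp add: Aut_def Iso_def self_isomorphism_iff)
qed

text \<open>For finite \<open>D\<close>, ultrahomogeneity makes this the orbit of \<open>x\<close>
  under the pointwise stabilizer of \<open>D\<close>. The form by finite relations composes directly
  with partial isomorphisms.\<close>

definition orbit_over :: "nat set \<Rightarrow> nat \<Rightarrow> nat set" where
  "orbit_over D x = {y. PI (insert (x, y) (Id_on D))}"

text \<open>The images of \<open>x\<close> under the stabilizer of \<open>D\<close> all lie in
  \<open>orbit_over D x\<close>, and no algebraicity provides infinitely many of them.\<close>

lemma infinite_orbit_over:
  assumes "finite D" "x \<notin> D"
  shows "infinite (orbit_over D x)"
proof -
  obtain xs where xs: "set xs = D" using finite_list[OF assms(1)] by blast
  have "(\<lambda>g. g x) ` pointwise_stabilizer L M xs \<subseteq> orbit_over D x"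
  proof clarsimp
    fix g assume "g \<in> pointwise_stabilizer L M xs"
    then have "PI (graph_on g UNIV)" "\<forall>y\<in>D. g y = y"
      by (auto simp: pointwise_stabilizer_def Aut_def Iso_def self_isomorphism_iff xs)
    then show "g x \<in> orbit_over D x"
      unfolding orbit_over_def by (auto elim: partial_iso_subset)
  qed
  moreover have "infinite ((\<lambda>g. g x) ` pointwise_stabilizer L M xs)"
    using no_alg assms xs unfolding no_algebraicity_def by auto
  ultimately show ?thesis using finite_subset by blast
qed

definition generic :: "nat set \<Rightarrow> bool" where
  "generic A \<longleftrightarrow> (\<forall>D x. finite D \<and> x \<notin> D \<longrightarrow>
     orbit_over D x \<inter> A \<noteq> {} \<and> orbit_over D x - A \<noteq> {})"

text \<open>Lets the extension lemmas below also place new points outside a generic set.\<close>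

lemma generic_Compl: "generic A \<Longrightarrow> generic (- A)"
  unfolding generic_def by blast

text \<open>An automorphism \<open>g\<close> extending \<open>R\<close> reduces the task to moving
  \<open>g x\<close> over \<open>Range R\<close>; the orbit of \<open>g x\<close> over that finite
  set meets \<open>A\<close>.\<close>

lemma generic_extend:
  assumes "generic A" "finite R" "PI R" "x \<notin> Domain R"
  obtains y where "y \<in> A" "PI (insert (x, y) R)"
proof -
  obtain g where g: "surj g" "PI (graph_on g UNIV)" "R \<subseteq> graph_on g UNIV"
    using finite_PI_extends assms(2,3) by blast
  have "g x \<notin> Range R"
  proof
    assume "g x \<in> Range R"
    then obtain z where z: "(z, g x) \<in> R" by blast
    with g(3) have "(z, g x) \<in> graph_on g UNIV" by blast
    then have "z = x" using partial_isoD2[OF g(2), of z "g x" x] by simp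
    with z assms(4) show False by blast
  qed
  then obtain y where y: "y \<in> A" "PI (insert (g x, y) (Id_on (Range R)))"
    using assms(1) finite_Range[OF assms(2)] unfolding generic_def orbit_over_def by blast
  \<comment> \<open>First \<open>g\<close>, then the map fixing \<open>Range R\<close> and sending
    \<open>g x\<close> to \<open>y\<close>: the composite contains \<open>R\<close> and sends
    \<open>x\<close> to \<open>y\<close>.\<close>
  have "insert (x, y) R \<subseteq> graph_on g UNIV O insert (g x, y) (Id_on (Range R))"
  proof -
    have "(a, b) \<in> graph_on g UNIV O insert (g x, y) (Id_on (Range R))" if "(a, b) \<in> R" for a b
    proof (rule relcompI)
      show "(a, b) \<in> graph_on g UNIV" using g(3) that by blast
      show "(b, b) \<in> insert (g x, y) (Id_on (Range R))" using that by blast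
    qed
    moreover have "(x, y) \<in> graph_on g UNIV O insert (g x, y) (Id_on (Range R))"
      by (rule relcompI[of _ "g x"]) auto
    ultimately show ?thesis by (intro subrelI) blast
  qed
  then show thesis
    using that y partial_iso_subset[OF partial_iso_comp[OF g(2) y(2)]] by blast
qed

text \<open>Realizes a finite structure of the age inside \<open>M\<close> with part of the copy
  prescribed by \<open>P\<close> and all further points in \<open>A\<close>. The points are added
  one at a time by \<open>generic_extend\<close>.\<close>

lemma generic_extend_embedding:
  assumes A: "generic A" and e: "embedding L S M e" and S: "finite (carr S)"
    and P: "finite P" "partial_iso L S M P" "Domain P \<subseteq> carr S"
  obtains P' where "P \<subseteq> P'" "finite P'" "partial_iso L S M P'" "Domain P' = carr S"
    "Range (P' - P) \<subseteq> A"
proof -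
  have "\<exists>P'. P \<subseteq> P' \<and> finite P' \<and> partial_iso L S M P' \<and> Domain P' = Domain P \<union> X \<and>
      Range (P' - P) \<subseteq> A" if "X \<subseteq> carr S" for X
    using finite_subset[OF that S] that
  proof (induction rule: finite_induct)
    case empty
    show ?case using P by (intro exI[of _ P]) auto
  next
    case (insert x X)
    then obtain P' where P': "P \<subseteq> P'" "finite P'" "partial_iso L S M P'"
      "Domain P' = Domain P \<union> X" "Range (P' - P) \<subseteq> A" by auto
    show ?case
    proof (cases "x \<in> Domain P'")
      case True
      then show ?thesis using P' by (intro exI[of _ P']) auto
    next
      case False
      \<comment> \<open>\<open>E\<close> is another copy of \<open>S\<close> in \<open>M\<close>, so
        \<open>E\<inverse> O P'\<close> compares two copies within \<open>M\<close>. Extending it at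
        \<open>e x\<close> and pulling back along \<open>E\<close> gives the image of
        \<open>x\<close>.\<close>
      define E where "E = graph_on e (carr S)"
      have E: "partial_iso L S M E" using e by (simp add: embedding_iff_partial_iso E_def)
      have x: "x \<in> carr S" using insert.prems by simp
      have "e x \<notin> Domain (E\<inverse> O P')"
      proof
        assume "e x \<in> Domain (E\<inverse> O P')"
        then obtain z where "(z, e x) \<in> E" "z \<in> Domain P'" by blast
        moreover have "(x, e x) \<in> E" using x by (simp add: E_def)
        ultimately show False using False partial_isoD2[OF E] by metis
      qed
      moreover have "finite (E\<inverse> O P')"
        using P'(2) S by (simp add: E_def)
      ultimately obtain y where y: "y \<in> A" "PI (insert (e x, y) (E\<inverse> O P'))"
        using generic_extend[OF A _ partial_iso_comp[OF partial_iso_converse[OF E] P'(3)]] by blast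
      have "insert (x, y) P' \<subseteq> E O insert (e x, y) (E\<inverse> O P')"
      proof -
        have "(a, b) \<in> E O (E\<inverse> O P')" if "(a, b) \<in> P'" for a b
        proof -
          have "(a, e a) \<in> E"
            using that P'(4) P(3) insert.prems by (auto simp: E_def)
          then show ?thesis using that by blast
        qed
        then have "P' \<subseteq> E O (E\<inverse> O P')" by (rule subrelI)
        also have "\<dots> \<subseteq> E O insert (e x, y) (E\<inverse> O P')" by (intro relcomp_mono) auto
        finally show ?thesis using relcompI[of x "e x" E y] x by (simp add: E_def)
      qed
      then have "partial_iso L S M (insert (x, y) P')"
        using partial_iso_subset[OF partial_iso_comp[OF E y(2)]] by blast
      then show ?thesis
        using P' y(1) by (intro exI[of _ "insert (x, y) P'"]) auto
    qed
  qed
  from this[of "carr S"] show thesis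
    using that P(3) by (metis Un_absorb1 subset_refl)
qed

text \<open>Back and forth through finite partial isomorphisms inside \<open>A \<times> B\<close>:
  genericity of \<open>B\<close> supplies images, that of \<open>A\<close> preimages.\<close>

lemma generic_Iso_extends:
  assumes A: "generic A" and B: "generic B" and R: "finite R" "PI R" "R \<subseteq> A \<times> B"
  obtains f where "f \<in> Iso L (substr M A) (substr M B)" "R \<subseteq> graph_on f A"
proof -
  let ?P = "\<lambda>R. finite R \<and> PI R \<and> R \<subseteq> A \<times> B"
  obtain Q where Q: "R \<subseteq> Q" "PI Q" "Q \<subseteq> A \<times> B" "A \<subseteq> Domain Q" "B \<subseteq> Range Q"
  proof (rule partial_iso_back_and_forth[of ?P R L M M "A \<times> B" A B])
    fix R x assume R: "?P R" and x: "x \<in> A"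
    show "\<exists>R'. R \<subseteq> R' \<and> ?P R' \<and> x \<in> Domain R'"
    proof (cases "x \<in> Domain R")
      case False
      then obtain y where "y \<in> B" "PI (insert (x, y) R)"
        using generic_extend[OF B] R by blast
      then show ?thesis using R x by (intro exI[of _ "insert (x, y) R"]) auto
    qed (use R in blast)
  next
    fix R y assume R: "?P R" and y: "y \<in> B"
    show "\<exists>R'. R \<subseteq> R' \<and> ?P R' \<and> y \<in> Range R'"
    proof (cases "y \<in> Range R")
      case False
      then obtain x where x: "x \<in> A" "PI (insert (y, x) (R\<inverse>))"
        using generic_extend[OF A, of "R\<inverse>" y] R by (auto simp: partial_iso_converse_iff)
      then have "PI (insert (x, y) R)"
        using partial_iso_converse[OF x(2)] by (auto elim: partial_iso_subset)
      then show ?thesis using R x y by (intro exI[of _ "insert (x, y) R"]) auto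
    qed (use R in blast)
  qed (use R in auto)
  then have "Domain Q = A" "Range Q = B" by auto
  with Q(1,2) show thesis
    using partial_iso_imp_Iso_substr that by metis
qed

lemma substr_in_Age:
  assumes "finite D"
  shows "substr M D \<in> Age L M"
proof -
  have "embedding L (substr M D) M (\<lambda>x. x)"
    by (auto simp: embedding_def substr_def)
  then show ?thesis using assms by (auto simp: Age_def)
qed

end

section \<open>Meager sets and spaces of functions with discrete values\<close>

lemma nowhere_dense_inI:
  assumes "N \<subseteq> topspace X"
    and "\<And>U. openin X U \<Longrightarrow> U \<noteq> {} \<Longrightarrow> \<exists>V. openin X V \<and> V \<noteq> {} \<and> V \<subseteq> U \<and> V \<inter> N = {}"
  shows "nowhere_dense_in X N"
proof -
  have False if ne: "X interior_of (X closure_of N) \<noteq> {}"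
  proof -
    \<comment> \<open>The criterion is applied to the interior of the closure itself.\<close>
    obtain V where V: "openin X V" "V \<noteq> {}" "V \<subseteq> X interior_of (X closure_of N)" "V \<inter> N = {}"
      using assms(2)[OF openin_interior_of ne] by blast
    from V(2) obtain x where x: "x \<in> V" by blast
    have "V \<subseteq> X closure_of N" using V(3) interior_of_subset by (rule subset_trans)
    with x have "x \<in> X closure_of N" by blast
    with x V(1) have "\<exists>y. y \<in> N \<and> y \<in> V" by (metis in_closure_of)
    with V(4) show False by blast
  qed
  then show ?thesis using assms(1) by (auto simp: nowhere_dense_in_def)
qed

lemma nowhere_dense_in_subset:
  assumes "nowhere_dense_in X N" "N' \<subseteq> N"
  shows "nowhere_dense_in X N'"
  using assms interior_of_mono[OF closure_of_mono[OF assms(2)], of X X]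
  by (auto simp: nowhere_dense_in_def)

text \<open>\<open>meager_in\<close> asks for a union equal to the set, so the nowhere dense pieces
  are intersected with \<open>T\<close>.\<close>

lemma meager_in_subset:
  assumes "meager_in X S" "T \<subseteq> S"
  shows "meager_in X T"
proof -
  obtain \<N> where \<N>: "countable \<N>" "\<forall>N\<in>\<N>. nowhere_dense_in X N" "S = \<Union>\<N>"
    using assms(1) by (auto simp: meager_in_def)
  have "T = \<Union>((\<lambda>N. N \<inter> T) ` \<N>)" using assms(2) \<N>(3) by blast
  moreover have "\<forall>N\<in>(\<lambda>N. N \<inter> T) ` \<N>. nowhere_dense_in X N"
    using \<N>(2) by (auto intro: nowhere_dense_in_subset)
  ultimately show ?thesis
    using \<N>(1) unfolding meager_in_def by (metis countable_image)
qed

lemma meager_in_Un: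
  assumes "meager_in X S" "meager_in X T"
  shows "meager_in X (S \<union> T)"
proof -
  obtain \<M> \<N> where "countable \<M>" "\<forall>N\<in>\<M>. nowhere_dense_in X N" "S = \<Union>\<M>"
    "countable \<N>" "\<forall>N\<in>\<N>. nowhere_dense_in X N" "T = \<Union>\<N>"
    using assms by (auto simp: meager_in_def)
  then show ?thesis
    unfolding meager_in_def by (intro exI[of _ "\<M> \<union> \<N>"]) auto
qed

lemma comeager_in_superset:
  assumes "comeager_in X S" "S \<subseteq> T" "T \<subseteq> topspace X"
  shows "comeager_in X T"
  using assms meager_in_subset[of X "topspace X - S" "topspace X - T"]
  by (auto simp: comeager_in_def)

text \<open>Closure and interior commute with products of two sets, so cylinders over nowhere dense
  sets are nowhere dense.\<close>

lemma meager_in_Times1: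
  assumes "meager_in X S"
  shows "meager_in (prod_topology X Y) (S \<times> topspace Y)"
proof -
  obtain \<N> where \<N>: "countable \<N>" "\<forall>N\<in>\<N>. nowhere_dense_in X N" "S = \<Union>\<N>"
    using assms by (auto simp: meager_in_def)
  then have "\<forall>N\<in>(\<lambda>N. N \<times> topspace Y) ` \<N>. nowhere_dense_in (prod_topology X Y) N"
    by (auto simp: nowhere_dense_in_def closure_of_Times interior_of_Times)
  moreover have "S \<times> topspace Y = \<Union>((\<lambda>N. N \<times> topspace Y) ` \<N>)"
    using \<N>(3) by auto
  ultimately show ?thesis
    using \<N>(1) unfolding meager_in_def by (metis countable_image)
qed

lemma meager_in_Times2:
  assumes "meager_in Y S"
  shows "meager_in (prod_topology X Y) (topspace X \<times> S)"
proof -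
  obtain \<N> where \<N>: "countable \<N>" "\<forall>N\<in>\<N>. nowhere_dense_in Y N" "S = \<Union>\<N>"
    using assms by (auto simp: meager_in_def)
  then have "\<forall>N\<in>(\<lambda>N. topspace X \<times> N) ` \<N>. nowhere_dense_in (prod_topology X Y) N"
    by (auto simp: nowhere_dense_in_def closure_of_Times interior_of_Times)
  moreover have "topspace X \<times> S = \<Union>((\<lambda>N. topspace X \<times> N) ` \<N>)"
    using \<N>(3) by auto
  ultimately show ?thesis
    using \<N>(1) unfolding meager_in_def by (metis countable_image)
qed

lemma comeager_in_Times:
  assumes "comeager_in X S" "comeager_in Y T"
  shows "comeager_in (prod_topology X Y) (S \<times> T)"
proof -
  have "topspace (prod_topology X Y) - S \<times> T =
      (topspace X - S) \<times> topspace Y \<union> topspace X \<times> (topspace Y - T)"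
    by auto
  then show ?thesis
    using assms by (auto simp: comeager_in_def
        intro!: meager_in_Un meager_in_Times1 meager_in_Times2)
qed

section \<open>Open sets as finitely determined conditions\<close>

text \<open>Basic open sets restrict finitely many factors, and in a discrete factor the restriction
  can be shrunk to a single value.\<close>

lemma openin_product_discrete_iff:
  "openin (product_topology (\<lambda>_. discrete_topology S) I) U \<longleftrightarrow>
     U \<subseteq> (I \<rightarrow>\<^sub>E S) \<and>
     (\<forall>x\<in>U. \<exists>F. finite F \<and> F \<subseteq> I \<and> (\<forall>y\<in>I \<rightarrow>\<^sub>E S. (\<forall>i\<in>F. y i = x i) \<longrightarrow> y \<in> U))"
    (is "?lhs \<longleftrightarrow> ?rhs")
proof
  assume U: ?lhs
  have "U \<subseteq> (I \<rightarrow>\<^sub>E S)" using openin_subset[OF U] by simp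
  moreover have "\<exists>F. finite F \<and> F \<subseteq> I \<and> (\<forall>y\<in>I \<rightarrow>\<^sub>E S. (\<forall>i\<in>F. y i = x i) \<longrightarrow> y \<in> U)"
    if x: "x \<in> U" for x
  proof -
    obtain W where W: "finite {i \<in> I. W i \<noteq> S}" "x \<in> Pi\<^sub>E I W" "Pi\<^sub>E I W \<subseteq> U"
      using U x unfolding openin_product_topology_alt by fastforce
    have "y \<in> Pi\<^sub>E I W" if "y \<in> I \<rightarrow>\<^sub>E S" "\<forall>i\<in>{i \<in> I. W i \<noteq> S}. y i = x i" for y
    proof (rule PiE_I)
      fix i assume "i \<in> I"
      then show "y i \<in> W i"
        using that W(2) by (cases "W i = S") (auto simp: PiE_iff)
    qed (use that in auto)
    then show ?thesis
      using W(1) by (intro exI[of _ "{i \<in> I. W i \<noteq> S}"] conjI ballI impI subsetD[OF W(3)]) auto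
  qed
  ultimately show ?rhs by blast
next
  assume U: ?rhs
  show ?lhs
    unfolding openin_product_topology_alt
  proof
    fix x assume x: "x \<in> U"
    with U obtain F where F: "finite F" "F \<subseteq> I"
      "\<forall>y\<in>I \<rightarrow>\<^sub>E S. (\<forall>i\<in>F. y i = x i) \<longrightarrow> y \<in> U" by blast
    have xS: "x \<in> I \<rightarrow>\<^sub>E S" using U x by blast
    let ?W = "\<lambda>i. if i \<in> F then {x i} else S"
    have "Pi\<^sub>E I ?W \<subseteq> U"
    proof
      fix y assume y: "y \<in> Pi\<^sub>E I ?W"
      have "y i = x i" if "i \<in> F" for i
        using PiE_mem[OF y, of i] F(2) that by auto
      moreover have "y \<in> I \<rightarrow>\<^sub>E S"
      proof (rule PiE_I)
        fix i assume "i \<in> I"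
        then show "y i \<in> S" using PiE_mem[OF y, of i] xS by (auto split: if_splits)
      qed (use y in auto)
      ultimately show "y \<in> U" using F(3) by blast
    qed
    moreover have "finite {i \<in> I. ?W i \<noteq> topspace (discrete_topology S)}"
      by (rule finite_subset[OF _ F(1)]) auto
    moreover have "\<forall>i\<in>I. openin (discrete_topology S) (?W i)" "x \<in> Pi\<^sub>E I ?W"
      using xS by (auto simp: PiE_iff)
    ultimately show "\<exists>W. finite {i \<in> I. W i \<noteq> topspace (discrete_topology S)} \<and>
        (\<forall>i\<in>I. openin (discrete_topology S) (W i)) \<and> x \<in> Pi\<^sub>E I W \<and> Pi\<^sub>E I W \<subseteq> U"
      by (intro exI[of _ ?W]) blast
  qed
qed

lemma openin_subtopology_discrete_product_iff:
  assumes "W \<subseteq> (I \<rightarrow>\<^sub>E S)"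
  shows "openin (subtopology (product_topology (\<lambda>_. discrete_topology S) I) W) U \<longleftrightarrow>
     U \<subseteq> W \<and> (\<forall>x\<in>U. \<exists>F. finite F \<and> F \<subseteq> I \<and> (\<forall>y\<in>W. (\<forall>i\<in>F. y i = x i) \<longrightarrow> y \<in> U))"
    (is "?lhs \<longleftrightarrow> ?rhs")
proof
  assume ?lhs
  then obtain V where V: "openin (product_topology (\<lambda>_. discrete_topology S) I) V" "U = V \<inter> W"
    by (auto simp: openin_subtopology)
  have "\<exists>F. finite F \<and> F \<subseteq> I \<and> (\<forall>y\<in>W. (\<forall>i\<in>F. y i = x i) \<longrightarrow> y \<in> U)" if "x \<in> U" for x
  proof -
    have "x \<in> V" using that V(2) by blast
    then have "\<exists>F. finite F \<and> F \<subseteq> I \<and> (\<forall>y\<in>I \<rightarrow>\<^sub>E S. (\<forall>i\<in>F. y i = x i) \<longrightarrow> y \<in> V)"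
      using V(1) unfolding openin_product_discrete_iff by (elim conjE bspec)
    then obtain F where F: "finite F" "F \<subseteq> I"
      "\<And>y. y \<in> I \<rightarrow>\<^sub>E S \<Longrightarrow> \<forall>i\<in>F. y i = x i \<Longrightarrow> y \<in> V" by auto
    have "\<forall>y\<in>W. (\<forall>i\<in>F. y i = x i) \<longrightarrow> y \<in> U"
      using F(3) V(2) assms by (simp add: subset_eq)
    with F(1,2) show ?thesis by blast
  qed
  with V(2) show ?rhs by simp
next
  assume U: ?rhs
  \<comment> \<open>\<open>?V\<close> collects the points for which agreement on some finite set
    already forces members of \<open>W\<close> into \<open>U\<close>. It is open because the same
    finite set serves all points agreeing there, and its trace on \<open>W\<close> is
    \<open>U\<close>.\<close>
  let ?V = "{z \<in> I \<rightarrow>\<^sub>E S. \<exists>F. finite F \<and> F \<subseteq> I \<and> (\<forall>y\<in>W. (\<forall>i\<in>F. y i = z i) \<longrightarrow> y \<in> U)}"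
  have "openin (product_topology (\<lambda>_. discrete_topology S) I) ?V"
    unfolding openin_product_discrete_iff
  proof (intro conjI ballI)
    fix x assume "x \<in> ?V"
    then obtain F where "finite F" "F \<subseteq> I" "\<forall>y\<in>W. (\<forall>i\<in>F. y i = x i) \<longrightarrow> y \<in> U"
      by (elim CollectE conjE exE)
    then show "\<exists>F. finite F \<and> F \<subseteq> I \<and> (\<forall>y\<in>I \<rightarrow>\<^sub>E S. (\<forall>i\<in>F. y i = x i) \<longrightarrow> y \<in> ?V)"
      by (intro exI[of _ F]) auto
  qed auto
  moreover have "U = ?V \<inter> W"
  proof
    show "U \<subseteq> ?V \<inter> W"
    proof
      fix x assume "x \<in> U"
      with U assms show "x \<in> ?V \<inter> W" by (simp add: subset_eq)
    qed
    show "?V \<inter> W \<subseteq> U" by auto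
  qed
  ultimately show ?lhs by (auto simp: openin_subtopology)
qed

lemma openin_Iso_space_iff:
  "openin (Iso_space L S T) U \<longleftrightarrow> U \<subseteq> Iso L S T \<and>
     (\<forall>f\<in>U. \<exists>F. finite F \<and> F \<subseteq> carr S \<and> (\<forall>g\<in>Iso L S T. (\<forall>x\<in>F. g x = f x) \<longrightarrow> g \<in> U))"
proof -
  have "Iso L S T \<subseteq> (carr S \<rightarrow>\<^sub>E carr T)"
    by (auto simp: Iso_def isomorphism_def embedding_def PiE_def)
  then show ?thesis
    unfolding Iso_space_def by (rule openin_subtopology_discrete_product_iff)
qed

text \<open>\<open>Collect\<close> inverts the passage from a set to its characteristic function, so
  the pullback topology is computed in the product.\<close>

lemma openin_cantor_space_iff:
  "openin cantor_space U \<longleftrightarrow> (\<forall>A\<in>U. \<exists>F. finite F \<and> (\<forall>B. B \<inter> F = A \<inter> F \<longrightarrow> B \<in> U))"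
    (is "_ \<longleftrightarrow> ?rhs")
proof -
  let ?c = "\<lambda>A n. n \<in> (A :: nat set)"
  have "openin cantor_space U \<longleftrightarrow>
      (\<exists>V. openin (product_topology (\<lambda>_. discrete_topology UNIV) UNIV) V \<and> U = ?c -` V)"
    by (simp add: cantor_space_def openin_pullback_topology)
  also have "\<dots> \<longleftrightarrow> openin (product_topology (\<lambda>_. discrete_topology UNIV) UNIV) {z. Collect z \<in> U}"
  proof -
    have "U = ?c -` V \<longleftrightarrow> V = {z. Collect z \<in> U}" for V
    proof
      show "V = {z. Collect z \<in> U}" if "U = ?c -` V" using that by simp
      show "U = ?c -` V" if "V = {z. Collect z \<in> U}" using that by simp
    qed
    then show ?thesis by simp
  qed
  also have "\<dots> \<longleftrightarrow> ?rhs"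
  proof -
    have *: "(\<forall>z. Collect z \<in> U \<longrightarrow> Q z) \<longleftrightarrow> (\<forall>A\<in>U. Q (?c A))" for Q
    proof (intro iffI allI impI ballI)
      show "Q (?c A)" if "\<forall>z. Collect z \<in> U \<longrightarrow> Q z" "A \<in> U" for A
        using that(1)[rule_format, of "?c A"] that(2) by simp
      show "Q z" if "\<forall>A\<in>U. Q (?c A)" "Collect z \<in> U" for z
        using that(1)[rule_format, of "Collect z"] that(2) by simp
    qed
    have **: "(\<forall>y. (\<forall>i\<in>F. y i = (i \<in> A)) \<longrightarrow> Collect y \<in> U) \<longleftrightarrow>
        (\<forall>B. B \<inter> F = A \<inter> F \<longrightarrow> B \<in> U)" for A F
    proof
      assume l: "\<forall>y. (\<forall>i\<in>F. y i = (i \<in> A)) \<longrightarrow> Collect y \<in> U"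
      show "\<forall>B. B \<inter> F = A \<inter> F \<longrightarrow> B \<in> U"
      proof (intro allI impI)
        fix B assume "B \<inter> F = A \<inter> F"
        then show "B \<in> U" using l[rule_format, of "?c B"] by auto
      qed
    next
      assume r: "\<forall>B. B \<inter> F = A \<inter> F \<longrightarrow> B \<in> U"
      show "\<forall>y. (\<forall>i\<in>F. y i = (i \<in> A)) \<longrightarrow> Collect y \<in> U"
      proof (intro allI impI)
        fix y assume "\<forall>i\<in>F. y i = (i \<in> A)"
        then show "Collect y \<in> U" using r[rule_format, of "Collect y"] by auto
      qed
    qed
    show ?thesis by (simp add: openin_product_discrete_iff * **)
  qed
  finally show ?thesis .
qed

text \<open>An open condition can be met by deciding finitely many numbers, so some \<open>n\<close>
  in the infinite set \<open>S\<close> remains free and is decided against \<open>b\<close>. The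
  values of \<open>b\<close> stand for \<open>S\<close> inside \<open>A\<close> and \<open>S\<close>
  disjoint from \<open>A\<close>.\<close>

lemma nowhere_dense_in_cantor_space:
  assumes "infinite S"
  shows "nowhere_dense_in cantor_space {A. \<forall>n\<in>S. n \<in> A \<longleftrightarrow> b}"
proof (rule nowhere_dense_inI)
  fix U assume U: "openin cantor_space U" "U \<noteq> {}"
  then obtain A where "A \<in> U" by blast
  with U(1) have "\<exists>F. finite F \<and> (\<forall>B. B \<inter> F = A \<inter> F \<longrightarrow> B \<in> U)"
    unfolding openin_cantor_space_iff by (rule bspec)
  then obtain F where A: "finite F" "\<And>B. B \<inter> F = A \<inter> F \<Longrightarrow> B \<in> U" by auto
  from assms A(1) obtain n where n: "n \<in> S" "n \<notin> F"
    by (meson finite_subset subsetI)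
  let ?A = "if b then A - {n} else insert n A"
  let ?V = "{B. B \<inter> insert n F = ?A \<inter> insert n F}"
  have "openin cantor_space ?V"
    using A(1) by (auto simp: openin_cantor_space_iff intro!: exI[of _ "insert n F"])
  moreover have "?A \<in> ?V" by blast
  moreover have "?V \<subseteq> U"
  proof
    fix B assume "B \<in> ?V"
    then have "B \<inter> F = A \<inter> F" using n(2) by (auto split: if_splits)
    then show "B \<in> U" by (rule A(2))
  qed
  moreover have "?V \<inter> {A. \<forall>n\<in>S. n \<in> A \<longleftrightarrow> b} = {}"
    using n(1) by (auto split: if_splits)
  ultimately show "\<exists>V. openin cantor_space V \<and> V \<noteq> {} \<and> V \<subseteq> U \<and>
      V \<inter> {A. \<forall>n\<in>S. n \<in> A \<longleftrightarrow> b} = {}"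
    by (intro exI[of _ ?V]) blast
qed simp

section \<open>Extending isomorphisms between generic substructures\<close>

context fraisse_no_algebraicity
begin

text \<open>Failure of splitting at the structure on \<open>C\<close> yields an extension
  \<open>D\<close> over which no splitting occurs. \<open>E\<close> is the rest of a copy of
  \<open>D\<close> over \<open>C\<close>, put inside \<open>A\<close>; a map \<open>T\<close> as
  described would split \<open>D\<close> unless it were a partial isomorphism.\<close>

lemma not_splits_rigid:
  assumes nsplit: "\<not> splits L (Age L M)" and A: "generic A" and C: "finite C" "C \<inter> A = {}"
  obtains E where "finite E" "E \<subseteq> A"
    "\<And>T. finite T \<Longrightarrow> single_valued T \<Longrightarrow> single_valued (T\<inverse>) \<Longrightarrow> C \<union> E \<subseteq> Domain T \<Longrightarrow>
      PI (T - C \<times> UNIV) \<Longrightarrow> PI (T \<inter> (C \<union> E) \<times> UNIV) \<Longrightarrow> PI T"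
proof -
  \<comment> \<open>The splitting clause at \<open>C\<close>; \<open>carr (substr M C)\<close> stays
    unsimplified to match the definition of \<open>splits\<close>.\<close>
  define Q where "Q D i \<longleftrightarrow> (\<exists>D1\<in>Age L M. \<exists>D2\<in>Age L M. \<exists>j1 j2 f.
      embedding L D D1 j1 \<and> embedding L D D2 j2 \<and>
      bij_betw f (carr D1) (carr D2) \<and> (\<forall>x\<in>carr D. f (j1 x) = j2 x) \<and>
      isomorphism L (substr D1 (carr D1 - j1 ` i ` carr (substr M C)))
        (substr D2 (carr D2 - j2 ` i ` carr (substr M C))) f \<and>
      \<not> isomorphism L D1 D2 f)" for D and i :: "nat \<Rightarrow> nat"
  have "\<not> (\<forall>D\<in>Age L M. \<forall>i. embedding L (substr M C) D i \<longrightarrow> Q D i)"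
  proof
    assume "\<forall>D\<in>Age L M. \<forall>i. embedding L (substr M C) D i \<longrightarrow> Q D i"
    then have "splits L (Age L M)"
      using substr_in_Age[OF C(1)] unfolding splits_def Q_def by (rule bexI)
    with nsplit show False ..
  qed
  then obtain D i where D: "D \<in> Age L M" "embedding L (substr M C) D i" and "\<not> Q D i"
    by blast
  then have rigid: "D1 \<in> Age L M \<Longrightarrow> D2 \<in> Age L M \<Longrightarrow>
      embedding L D D1 j1 \<Longrightarrow> embedding L D D2 j2 \<Longrightarrow> bij_betw f (carr D1) (carr D2) \<Longrightarrow>
      \<forall>x\<in>carr D. f (j1 x) = j2 x \<Longrightarrow>
      isomorphism L (substr D1 (carr D1 - j1 ` i ` carr (substr M C)))
        (substr D2 (carr D2 - j2 ` i ` carr (substr M C))) f \<Longrightarrow>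
      isomorphism L D1 D2 f" for D1 D2 j1 j2 f
    unfolding Q_def by blast
  obtain e where e: "embedding L D M e" and D_fin: "finite (carr D)"
    using D(1) by (auto simp: Age_def)
  define J where "J = graph_on i C"
  have iC: "i ` C \<subseteq> carr D" and "partial_iso L (substr M C) D J"
    using D(2) by (simp_all add: embedding_iff_partial_iso J_def)
  then have J: "partial_iso L M D J"
    by (simp add: partial_iso_substr_left J_def)
  \<comment> \<open>The copy of \<open>D\<close> sends \<open>i c\<close> back to \<open>c\<close>
    and every other point into \<open>A\<close>.\<close>
  obtain P where P: "J\<inverse> \<subseteq> P" "finite P" "partial_iso L D M P" "Domain P = carr D"
    "Range (P - J\<inverse>) \<subseteq> A"
  proof (rule generic_extend_embedding[OF A e D_fin])
    show "finite (J\<inverse>)" using C(1) by (simp add: J_def)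
    show "partial_iso L D M (J\<inverse>)" using J by (rule partial_iso_converse)
    show "Domain (J\<inverse>) \<subseteq> carr D" using iC by (simp add: J_def)
  qed
  obtain j where j: "P = graph_on j (carr D)"
    using partial_iso_graph_ex[OF P(3)] P(4) by metis
  define E where "E = Range (P - J\<inverse>)"
  have jD: "j ` carr D = C \<union> E"
  proof -
    have "Range P = Range (J\<inverse>) \<union> E" using P(1) unfolding E_def by blast
    then show ?thesis by (simp add: j J_def)
  qed
  have ji: "j (i c) = c" if "c \<in> C" for c
  proof -
    have "(i c, c) \<in> P" using P(1) that by (auto simp: J_def)
    then show ?thesis by (simp add: j)
  qed
  show thesis
  proof (rule that)
    show "finite E" using P(2) by (simp add: E_def finite_Range)
    show "E \<subseteq> A" using P(5) by (simp add: E_def)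
    fix T assume T: "finite T" "single_valued T" "single_valued (T\<inverse>)" "C \<union> E \<subseteq> Domain T"
      and off: "PI (T - C \<times> UNIV)" and on: "PI (T \<inter> (C \<union> E) \<times> UNIV)"
    obtain f X where f: "T = graph_on f X" "inj_on f X" and X: "X = Domain T"
      using single_valued_graph_ex[OF T(2,3)] by blast
    have X_fin: "finite X" using T(1) by (simp add: X finite_Domain)
    have sub: "C \<union> E \<subseteq> X" using T(4) by (simp add: X)
    \<comment> \<open>Rigidity is applied to the structures on the domain and the range of
      \<open>T\<close>, with \<open>D\<close> embedded by \<open>j\<close> and by
      \<open>f \<circ> j\<close>; the assumption \<open>on\<close> makes the latter an
      embedding.\<close>
    have "isomorphism L (substr M X) (substr M (f ` X)) f"
    proof (rule rigid)
      show "substr M X \<in> Age L M" "substr M (f ` X) \<in> Age L M"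
        using X_fin by (simp_all add: substr_in_Age)
      show "embedding L D (substr M X) j"
        using P(3) jD sub j by (simp add: embedding_iff_partial_iso partial_iso_substr_right)
      have "(d, f (j d)) \<in> P O (T \<inter> (C \<union> E) \<times> UNIV)" if "d \<in> carr D" for d
      proof (rule relcompI)
        show "(d, j d) \<in> P" using that by (simp add: j)
        have "j d \<in> C \<union> E" using jD that by blast
        then show "(j d, f (j d)) \<in> T \<inter> (C \<union> E) \<times> UNIV"
          using sub by (auto simp: f(1))
      qed
      then have "graph_on (f \<circ> j) (carr D) \<subseteq> P O (T \<inter> (C \<union> E) \<times> UNIV)"
        by (intro subrelI) (simp del: relcomp.simps)
      then have "partial_iso L D M (graph_on (f \<circ> j) (carr D))"
        by (rule partial_iso_subset[OF partial_iso_comp[OF P(3) on]])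
      moreover have "(f \<circ> j) ` carr D \<subseteq> f ` X"
        using jD sub by auto
      ultimately show "embedding L D (substr M (f ` X)) (f \<circ> j)"
        by (simp add: embedding_iff_partial_iso partial_iso_substr_right)
      show "bij_betw f (carr (substr M X)) (carr (substr M (f ` X)))"
        using f(2) by (simp add: bij_betw_def)
      show "\<forall>x\<in>carr D. f (j x) = (f \<circ> j) x" by simp
      \<comment> \<open>\<open>j\<close> undoes \<open>i\<close> on \<open>C\<close>, so the part
        removed in the definition of splitting is \<open>C\<close> on one side and its image under
        \<open>f\<close> on the other.\<close>
      have "j ` i ` C = C" using ji by (force simp: image_image)
      moreover from this have "(f \<circ> j) ` i ` C = f ` C" by (metis image_comp)
      moreover have "f ` (X - C) = f ` X - f ` C"
        using f(2) sub by (intro inj_on_image_set_diff[of f X]) auto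
      moreover have "graph_on f (X - C) = T - C \<times> UNIV" by (auto simp: f(1))
      moreover have "graph_on f (X - C) \<subseteq> X \<times> (f ` X)" by auto
      ultimately show "isomorphism L
          (substr (substr M X) (carr (substr M X) - j ` i ` carr (substr M C)))
          (substr (substr M (f ` X)) (carr (substr M (f ` X)) - (f \<circ> j) ` i ` carr (substr M C))) f"
        using off by (simp add: isomorphism_substr_iff partial_iso_substr)
    qed
    then show "PI T" by (simp add: isomorphism_substr_iff f(1))
  qed
qed

text \<open>It is enough that \<open>y\<close> realizes the type of \<open>x\<close> over a finite
  part of \<open>R\<close>; rigidity propagates this to all of \<open>R\<close>, which contains the
  infinite isomorphism \<open>F\<close>.\<close>

lemma not_splits_extend:
  assumes nsplit: "\<not> splits L (Age L M)" and A: "generic A" and B: "generic B"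
    and F: "F \<subseteq> R" "Domain F = A" "Range F = B"
    and R: "PI R" "finite (R - F)" "R - F \<subseteq> (- A) \<times> (- B)" and x: "x \<notin> Domain R"
  obtains y where "y \<notin> B" "PI (insert (x, y) R)"
proof -
  define C where "C = insert x (Domain (R - F))"
  have "x \<notin> A" using x F(1,2) by blast
  have C: "finite C" "C \<inter> A = {}"
    using R(2,3) \<open>x \<notin> A\<close> by (auto simp: C_def finite_Domain)
  obtain E where E: "finite E" "E \<subseteq> A"
    and rigid: "\<And>T. finite T \<Longrightarrow> single_valued T \<Longrightarrow> single_valued (T\<inverse>) \<Longrightarrow> C \<union> E \<subseteq> Domain T \<Longrightarrow>
      PI (T - C \<times> UNIV) \<Longrightarrow> PI (T \<inter> (C \<union> E) \<times> UNIV) \<Longrightarrow> PI T"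
    using not_splits_rigid[OF nsplit A C] by blast
  obtain f where f: "F = graph_on f A"
    using partial_iso_graph_ex[OF partial_iso_subset[OF R(1) F(1)]] F(2) by metis
  \<comment> \<open>The finite part consists of the pairs added to \<open>F\<close> and of
    \<open>F\<close> on the set \<open>E\<close> that controls \<open>C\<close>.\<close>
  define R0 where "R0 = (R - F) \<union> graph_on f E"
  have "graph_on f E \<subseteq> F" using E(2) by (auto simp: f)
  then have R0: "finite R0" "R0 \<subseteq> R"
    using R(2) E(1) F(1) by (auto simp: R0_def)
  obtain y where y: "y \<in> - B" "PI (insert (x, y) R0)"
    using generic_extend[OF generic_Compl[OF B] R0(1) partial_iso_subset[OF R(1) R0(2)]]
      x R0(2) by blast
  \<comment> \<open>As \<open>y\<close> is outside \<open>B\<close>, a preimage under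
    \<open>R\<close> would already be one under \<open>R0\<close>, where injectivity identifies it
    with \<open>x\<close>.\<close>
  have y_new: "y \<notin> Range R"
  proof
    assume "y \<in> Range R"
    then obtain z where z: "(z, y) \<in> R" by blast
    moreover have "(z, y) \<notin> F" using F(3) y(1) by blast
    ultimately have "(z, y) \<in> insert (x, y) R0" by (simp add: R0_def)
    then have "z = x" using partial_isoD2[OF y(2), of z y x] by simp
    then show False using z x by blast
  qed
  have sv: "single_valued (insert (x, y) R)" "single_valued ((insert (x, y) R)\<inverse>)"
    using partial_isoD1[OF R(1)] partial_isoD2[OF R(1)] x y_new
    by (auto simp: single_valued_def)
  have "PI (insert (x, y) R)"
  proof (rule partial_iso_finite_character)
    fix T assume T: "finite T" "T \<subseteq> insert (x, y) R"
    \<comment> \<open>\<open>T\<close> is enlarged until its domain covers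
      \<open>C \<union> E\<close>. Off \<open>C\<close> the result lies in \<open>R\<close>, and
      over \<open>C \<union> E\<close> it lies in \<open>insert (x, y) R0\<close>, so rigidity
      applies.\<close>
    define T' where "T' = T \<union> insert (x, y) R0"
    have T': "T' \<subseteq> insert (x, y) R" using T(2) R0(2) by (auto simp: T'_def)
    have "PI T'"
    proof (rule rigid)
      show "finite T'" using T(1) R0(1) by (simp add: T'_def)
      show "single_valued T'" using sv(1) T' by (rule single_valued_subset[rotated])
      show "single_valued (T'\<inverse>)"
        using sv(2) T' by (meson converse_mono single_valued_subset)
      show "C \<union> E \<subseteq> Domain T'" by (auto simp: T'_def C_def R0_def)
      have "T' - C \<times> UNIV \<subseteq> R"
        using T' by (auto simp: C_def)
      then show "PI (T' - C \<times> UNIV)" by (rule partial_iso_subset[OF R(1)])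
      have "(a, b) \<in> insert (x, y) R0" if ab: "(a, b) \<in> T'" "a \<in> C \<union> E" for a b
      proof (cases "(a, b) = (x, y)")
        case False
        with ab T' have "(a, b) \<in> R" by blast
        show ?thesis
        proof (cases "(a, b) \<in> F")
          case True
          then have "a \<in> E" using ab(2) C(2) by (auto simp: f)
          with True show ?thesis by (simp add: R0_def f)
        qed (use \<open>(a, b) \<in> R\<close> in \<open>simp add: R0_def\<close>)
      qed simp
      then have "T' \<inter> (C \<union> E) \<times> UNIV \<subseteq> insert (x, y) R0" by blast
      then show "PI (T' \<inter> (C \<union> E) \<times> UNIV)" by (rule partial_iso_subset[OF y(2)])
    qed
    then show "PI T" by (rule partial_iso_subset) (auto simp: T'_def)
  qed
  with y(1) show thesis using that by blast
qed

lemma not_splits_global: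
  assumes nsplit: "\<not> splits L (Age L M)" and A: "generic A" and B: "generic B"
  shows "global_pair L M A B"
proof -
  have "\<exists>g\<in>Aut L M. \<forall>x\<in>A. g x = f x" if "f \<in> Iso L (substr M A) (substr M B)" for f
  proof -
    define F where "F = graph_on f A"
    have F: "PI F" "Domain F = A" "Range F = B"
      using that by (auto simp: Iso_substr_iff F_def)
    \<comment> \<open>The chain starts from the whole of \<open>F\<close>; each stage has added only
      finitely many pairs, all outside \<open>A\<close> and \<open>B\<close>, as
      \<open>not_splits_extend\<close> requires.\<close>
    let ?P = "\<lambda>R. PI R \<and> F \<subseteq> R \<and> finite (R - F) \<and> R - F \<subseteq> (- A) \<times> (- B)"
    have step: "?P (insert (x, y) R)"
      if "?P R" "x \<notin> A" "y \<notin> B" "PI (insert (x, y) R)" for R x y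
    proof -
      have "insert (x, y) R - F \<subseteq> insert (x, y) (R - F)" by blast
      moreover from this have "finite (insert (x, y) R - F)"
        using that(1) finite_subset by blast
      ultimately show ?thesis using that by blast
    qed
    obtain Q where Q: "F \<subseteq> Q" "PI Q" "UNIV \<subseteq> Domain Q" "UNIV \<subseteq> Range Q"
    proof (rule partial_iso_back_and_forth[of ?P F L M M UNIV UNIV UNIV])
      fix R and x :: nat assume R: "?P R"
      show "\<exists>R'. R \<subseteq> R' \<and> ?P R' \<and> x \<in> Domain R'"
      proof (cases "x \<in> Domain R")
        case False
        then obtain y where y: "y \<notin> B" "PI (insert (x, y) R)"
          using not_splits_extend[OF nsplit A B, of F R x] R F by metis
        have "x \<notin> A" using False R F(2) by blast
        then have "?P (insert (x, y) R)" using step R y by blast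
        then show ?thesis by (intro exI[of _ "insert (x, y) R"]) auto
      qed (use R in blast)
    next
      fix R and y :: nat assume R: "?P R"
      show "\<exists>R'. R \<subseteq> R' \<and> ?P R' \<and> y \<in> Range R'"
      proof (cases "y \<in> Range R")
        case False
        \<comment> \<open>Preimages come from the same extension lemma, applied to the converses
          with \<open>A\<close> and \<open>B\<close> interchanged.\<close>
        have "R\<inverse> - F\<inverse> = (R - F)\<inverse>" by auto
        then have "finite (R\<inverse> - F\<inverse>)" "R\<inverse> - F\<inverse> \<subseteq> (- B) \<times> (- A)"
          using R by auto
        moreover have "PI (R\<inverse>)" "F\<inverse> \<subseteq> R\<inverse>"
          using R by (auto simp: partial_iso_converse_iff)
        ultimately obtain x where x: "x \<notin> A" "PI (insert (y, x) (R\<inverse>))"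
          using not_splits_extend[OF nsplit B A, of "F\<inverse>" "R\<inverse>" y] F False
          by (metis Domain_converse Range_converse)
        have "insert (x, y) R = (insert (y, x) (R\<inverse>))\<inverse>" by auto
        then have "PI (insert (x, y) R)" using partial_iso_converse[OF x(2)] by simp
        moreover have "y \<notin> B" using False R F(3) by blast
        ultimately have "?P (insert (x, y) R)" using step R x(1) by blast
        then show ?thesis by (intro exI[of _ "insert (x, y) R"]) auto
      qed (use R in blast)
    qed (use F(1) in auto)
    obtain g where g: "Q = graph_on g UNIV"
      using partial_iso_graph_ex[OF Q(2)] Q(3) by (metis top.extremum_uniqueI)
    have "surj g" using Q(4) by (simp add: g top.extremum_unique)
    then have "g \<in> Aut L M"
      using Q(2) g by (simp add: Aut_def Iso_def self_isomorphism_iff)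
    moreover have "g x = f x" if "x \<in> A" for x
    proof -
      have "(x, f x) \<in> Q" using Q(1) that by (auto simp: F_def)
      then show ?thesis by (simp add: g)
    qed
    ultimately show ?thesis by blast
  qed
  then show ?thesis
    unfolding global_pair_def extendable_isos_def by blast
qed

end

section \<open>Destroying extensions when the age splits\<close>

context fraisse_no_algebraicity
begin

text \<open>\<open>C\<close> is a copy of a splitting witness outside \<open>A\<close>. Splitting
  over the structure on \<open>Domain R\<close> yields \<open>D1\<close> and \<open>D2\<close>;
  placing them in \<open>M\<close> around the domain and the range of \<open>R\<close> turns the
  splitting bijection into \<open>T\<close>.\<close>

lemma splits_break:
  assumes split: "splits L (Age L M)" and A: "generic A"
  obtains C where "finite C" "C \<inter> A = {}"
    "\<And>B R. generic B \<Longrightarrow> finite R \<Longrightarrow> PI R \<Longrightarrow> C \<subseteq> Domain R \<Longrightarrow>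
      \<exists>T. R \<subseteq> T \<and> finite T \<and> \<not> PI T \<and> PI (T - C \<times> UNIV) \<and> T - R \<subseteq> A \<times> B"
proof -
  define Q where "Q C D i \<longleftrightarrow> (\<exists>D1\<in>Age L M. \<exists>D2\<in>Age L M. \<exists>j1 j2 f.
      embedding L D D1 j1 \<and> embedding L D D2 j2 \<and>
      bij_betw f (carr D1) (carr D2) \<and> (\<forall>x\<in>carr D. f (j1 x) = j2 x) \<and>
      isomorphism L (substr D1 (carr D1 - j1 ` i ` carr C))
        (substr D2 (carr D2 - j2 ` i ` carr C)) f \<and>
      \<not> isomorphism L D1 D2 f)" for C D :: "('r, nat) struct" and i :: "nat \<Rightarrow> nat"
  have "\<exists>C\<in>Age L M. \<forall>D\<in>Age L M. \<forall>i. embedding L C D i \<longrightarrow> Q C D i"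
    using split unfolding splits_def Q_def .
  then obtain C0 where C0: "C0 \<in> Age L M"
    and C0_split: "\<And>D i. D \<in> Age L M \<Longrightarrow> embedding L C0 D i \<Longrightarrow> Q C0 D i" by blast
  obtain e0 where e0: "embedding L C0 M e0" and C0_fin: "finite (carr C0)"
    using C0 by (auto simp: Age_def)
  \<comment> \<open>From the empty map every point of the copy is new, and so lands in the
    complement of \<open>A\<close>.\<close>
  have "partial_iso L C0 M {}"
    using e0 by (auto simp: embedding_iff_partial_iso elim: partial_iso_subset)
  then obtain P where P: "partial_iso L C0 M P" "Domain P = carr C0" "Range P \<subseteq> - A"
    using generic_extend_embedding[OF generic_Compl[OF A] e0 C0_fin, of "{}"]
    by (metis Diff_empty Domain_empty empty_subsetI finite.emptyI)
  obtain e where e: "P = graph_on e (carr C0)"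
    using partial_iso_graph_ex[OF P(1)] P(2) by metis
  define C where "C = e ` carr C0"
  show thesis
  proof (rule that)
    show "finite C" using C0_fin by (simp add: C_def)
    show "C \<inter> A = {}" using P(3) by (auto simp: e C_def)
    fix B R assume B: "generic B" and R: "finite R" "PI R" "C \<subseteq> Domain R"
    define D where "D = substr M (Domain R)"
    have D: "carr D = Domain R" "D \<in> Age L M" "finite (Domain R)"
      using R(1) by (simp_all add: D_def substr_in_Age finite_Domain)
    have "embedding L C0 D e"
      using P(1) R(3)
      by (simp add: embedding_iff_partial_iso D_def partial_iso_substr_right e C_def)
    then have "Q C0 D e" using D(2) by (intro C0_split)
    then obtain D1 D2 j1 j2 f where D12: "D1 \<in> Age L M" "D2 \<in> Age L M"
      and j1: "embedding L D D1 j1" and j2: "embedding L D D2 j2"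
      and f: "bij_betw f (carr D1) (carr D2)" "\<And>x. x \<in> Domain R \<Longrightarrow> f (j1 x) = j2 x"
      and off: "isomorphism L (substr D1 (carr D1 - j1 ` C)) (substr D2 (carr D2 - j2 ` C)) f"
      and not_iso: "\<not> isomorphism L D1 D2 f"
      unfolding Q_def C_def D(1) by (elim bexE exE conjE) blast
    obtain e1 e2 where e1: "embedding L D1 M e1" "finite (carr D1)"
      and e2: "embedding L D2 M e2" "finite (carr D2)"
      using D12 by (auto simp: Age_def)
    define J1 J2 where J_def: "J1 = graph_on j1 (Domain R)" "J2 = graph_on j2 (Domain R)"
    have J: "partial_iso L M D1 J1" "partial_iso L M D2 J2"
      and J_carr: "j1 ` Domain R \<subseteq> carr D1" "j2 ` Domain R \<subseteq> carr D2"
      using j1 j2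
      by (simp_all add: embedding_iff_partial_iso D_def partial_iso_substr_left J_def)
    \<comment> \<open>\<open>P1\<close> sends \<open>j1 x\<close> back to \<open>x\<close> and the
      new points of \<open>D1\<close> into \<open>A\<close>.\<close>
    obtain P1 where P1: "J1\<inverse> \<subseteq> P1" "finite P1" "partial_iso L D1 M P1" "Domain P1 = carr D1"
      "Range (P1 - J1\<inverse>) \<subseteq> A"
    proof (rule generic_extend_embedding[OF A e1])
      show "finite (J1\<inverse>)" using D(3) by (simp add: J_def)
      show "partial_iso L D1 M (J1\<inverse>)" using J(1) by (rule partial_iso_converse)
      show "Domain (J1\<inverse>) \<subseteq> carr D1" using J_carr(1) by (simp add: J_def)
    qed
    \<comment> \<open>\<open>P2\<close> sends \<open>j2 x\<close> to the partner of \<open>x\<close>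
      under \<open>R\<close>, so \<open>D2\<close> is built over \<open>Range R\<close>, with new
      points in \<open>B\<close>.\<close>
    obtain P2 where P2: "J2\<inverse> O R \<subseteq> P2" "finite P2" "partial_iso L D2 M P2"
      "Domain P2 = carr D2" "Range (P2 - J2\<inverse> O R) \<subseteq> B"
    proof (rule generic_extend_embedding[OF B e2])
      show "finite (J2\<inverse> O R)" using D(3) R(1) by (simp add: J_def)
      show "partial_iso L D2 M (J2\<inverse> O R)"
        using partial_iso_converse[OF J(2)] R(2) by (rule partial_iso_comp)
      show "Domain (J2\<inverse> O R) \<subseteq> carr D2" using J_carr(2) by (auto simp: J_def)
    qed
    \<comment> \<open>\<open>T\<close> is \<open>f\<close> seen through the two placements; it
      contains \<open>R\<close> because \<open>f\<close> takes \<open>j1 x\<close> to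
      \<open>j2 x\<close>.\<close>
    define T where "T = P1\<inverse> O graph_on f (carr D1) O P2"
    have T_I: "(a, b) \<in> T" if "(d, a) \<in> P1" "(f d, b) \<in> P2" for a b d
    proof -
      have "d \<in> carr D1" using that(1) P1(4) by blast
      then show ?thesis using that unfolding T_def by (intro relcompI[of a d]) auto
    qed
    have T_E: "\<exists>d. (d, a) \<in> P1 \<and> (f d, b) \<in> P2" if "(a, b) \<in> T" for a b
      using that by (auto simp: T_def)
    have J1_P1: "(j1 x, x) \<in> P1" if "x \<in> Domain R" for x
    proof -
      have "(j1 x, x) \<in> J1\<inverse>" using that by (simp add: J_def)
      then show ?thesis using P1(1) by blast
    qed
    have J2_P2: "(j2 x, y) \<in> P2" if "(x, y) \<in> R" for x y
    proof -
      have "(j2 x, x) \<in> J2\<inverse>" using that by (auto simp: J_def)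
      then show ?thesis using P2(1) that by blast
    qed
    have "R \<subseteq> T"
    proof (rule subrelI)
      fix x y assume xy: "(x, y) \<in> R"
      then have x: "x \<in> Domain R" by blast
      show "(x, y) \<in> T"
        using J1_P1[OF x] J2_P2[OF xy] f(2)[OF x] by (intro T_I[of "j1 x"]) auto
    qed
    moreover have "finite T" using P1(2) P2(2) e1(2) by (simp add: T_def)
    moreover have "T - R \<subseteq> A \<times> B"
    proof (rule subrelI)
      fix a b assume ab: "(a, b) \<in> T - R"
      then obtain d where d: "(d, a) \<in> P1" "(f d, b) \<in> P2" using T_E by blast
      \<comment> \<open>A new pair comes from a point \<open>d\<close> outside the image of
        \<open>Domain R\<close>; injectivity of \<open>f\<close> then keeps \<open>f d\<close>
        outside its image in \<open>D2\<close>.\<close>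
      have d_new: "d \<noteq> j1 x" if x: "x \<in> Domain R" for x
      proof
        assume dx: "d = j1 x"
        then have "a = x" using partial_isoD1[OF P1(3) d(1)] J1_P1[OF x] by simp
        obtain y where y: "(x, y) \<in> R" using x by blast
        then have "b = y" using partial_isoD1[OF P2(3) d(2)] J2_P2[OF y] f(2)[OF x] dx by simp
        with \<open>a = x\<close> y ab show False by simp
      qed
      then have "(d, a) \<notin> J1\<inverse>" by (auto simp: J_def)
      then have "a \<in> A" using d(1) P1(5) by blast
      have "(f d, z) \<notin> J2\<inverse>" for z
      proof
        assume "(f d, z) \<in> J2\<inverse>"
        then have z: "z \<in> Domain R" "f d = f (j1 z)" using f(2) by (auto simp: J_def)
        have "d \<in> carr D1" using d(1) P1(4) by blast
        then have "d = j1 z"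
          using inj_onD[OF bij_betw_imp_inj_on[OF f(1)] z(2)] J_carr(1) z(1) by blast
        with d_new z(1) show False by blast
      qed
      then have "(f d, b) \<notin> J2\<inverse> O R" by blast
      then have "b \<in> B" using d(2) P2(5) by blast
      with \<open>a \<in> A\<close> show "(a, b) \<in> A \<times> B" by simp
    qed
    moreover have "\<not> PI T"
    proof
      assume T: "PI T"
      \<comment> \<open>Undoing the placements recovers \<open>f\<close> from \<open>T\<close>, so
        if \<open>T\<close> were a partial isomorphism, \<open>f\<close> would be an
        isomorphism.\<close>
      have "graph_on f (carr D1) \<subseteq> P1 O T O P2\<inverse>"
      proof (rule subrelI)
        fix d d' assume "(d, d') \<in> graph_on f (carr D1)"
        then have d: "d \<in> carr D1" "d' = f d" by auto
        then have "f d \<in> carr D2" using f(1) by (auto simp: bij_betw_def)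
        with d P1(4) P2(4) obtain a b where ab: "(d, a) \<in> P1" "(f d, b) \<in> P2" by blast
        then have "(a, b) \<in> T" by (rule T_I)
        with ab d(2) show "(d, d') \<in> P1 O T O P2\<inverse>" by blast
      qed
      then have "partial_iso L D1 D2 (graph_on f (carr D1))"
        using partial_iso_comp[OF P1(3) partial_iso_comp[OF T partial_iso_converse[OF P2(3)]]]
        by (rule partial_iso_subset[rotated])
      then show False
        using not_iso f(1) by (simp add: isomorphism_iff_partial_iso bij_betw_def)
    qed
    moreover have "PI (T - C \<times> UNIV)"
    proof -
      have F: "partial_iso L D1 D2 (graph_on f (carr D1 - j1 ` C))"
        using off by (simp add: isomorphism_substr_iff)
      \<comment> \<open>Pairs starting outside \<open>C\<close> come from points outside the image
        of \<open>C\<close> in \<open>D1\<close>, where \<open>f\<close> is an isomorphism by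
        \<open>off\<close>.\<close>
      have "T - C \<times> UNIV \<subseteq> P1\<inverse> O graph_on f (carr D1 - j1 ` C) O P2"
      proof (rule subrelI)
        fix a b assume ab: "(a, b) \<in> T - C \<times> UNIV"
        then obtain d where d: "(d, a) \<in> P1" "(f d, b) \<in> P2" using T_E by blast
        have "d \<notin> j1 ` C"
        proof
          assume "d \<in> j1 ` C"
          then obtain c where c: "c \<in> C" "d = j1 c" by blast
          then have "a = c" using partial_isoD1[OF P1(3) d(1)] J1_P1[of c] R(3) by auto
          with c(1) ab show False by simp
        qed
        moreover have "d \<in> carr D1" using d(1) P1(4) by blast
        ultimately show "(a, b) \<in> P1\<inverse> O graph_on f (carr D1 - j1 ` C) O P2"
          using d by (intro relcompI[of a d]) auto
      qed
      then show ?thesis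
        using partial_iso_comp[OF partial_iso_converse[OF P1(3)] partial_iso_comp[OF F P2(3)]]
        by (rule partial_iso_subset[rotated])
    qed
    ultimately show "\<exists>T. R \<subseteq> T \<and> finite T \<and> \<not> PI T \<and> PI (T - C \<times> UNIV) \<and> T - R \<subseteq> A \<times> B"
      by blast
  qed
qed

lemma splits_strongly_nonglobal:
  assumes split: "splits L (Age L M)" and A: "generic A" and B: "generic B"
  shows "strongly_nonglobal_pair L M A B"
proof -
  let ?I = "Iso L (substr M A) (substr M B)"
  let ?X = "Iso_space L (substr M A) (substr M B)"
  obtain C where C: "finite C" "C \<inter> A = {}"
    and break: "\<And>R. finite R \<Longrightarrow> PI R \<Longrightarrow> C \<subseteq> Domain R \<Longrightarrow>
      \<exists>T. R \<subseteq> T \<and> finite T \<and> \<not> PI T \<and> PI (T - C \<times> UNIV) \<and> T - R \<subseteq> A \<times> B"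
    using splits_break[OF split A] B by metis
  \<comment> \<open>Arbitrary relations \<open>r\<close> are allowed; \<open>N r\<close> is empty if
    \<open>r\<close> is not a partial isomorphism.\<close>
  define N where "N r = {f \<in> ?I. PI (graph_on f A \<union> r)}" for r
  have nowhere_dense: "nowhere_dense_in ?X (N r)" if r: "finite r" "Domain r = C" for r
  proof (rule nowhere_dense_inI)
    show "N r \<subseteq> topspace ?X" by (auto simp: N_def)
    fix U assume U: "openin ?X U" "U \<noteq> {}"
    then obtain f0 where f0: "f0 \<in> U" "f0 \<in> ?I"
      using openin_subset[OF U(1)] by auto
    have "\<exists>F. finite F \<and> F \<subseteq> carr (substr M A) \<and>
        (\<forall>g\<in>?I. (\<forall>x\<in>F. g x = f0 x) \<longrightarrow> g \<in> U)"
      using U(1) f0(1) unfolding openin_Iso_space_iff by (elim conjE bspec)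
    then obtain F0 where F0: "finite F0" "F0 \<subseteq> A"
      "\<And>g. g \<in> ?I \<Longrightarrow> \<forall>x\<in>F0. g x = f0 x \<Longrightarrow> g \<in> U" by auto
    \<comment> \<open>Within the neighbourhood of \<open>f0\<close> determined by \<open>F0\<close>,
      a smaller one, around some \<open>f\<close> and determined by \<open>F\<close>, has to miss
      \<open>N r\<close>.\<close>
    obtain f F where f: "f \<in> ?I" "\<forall>x\<in>F0. f x = f0 x"
      and F: "finite F" "F0 \<subseteq> F" "F \<subseteq> A"
      and avoid: "\<And>g. g \<in> ?I \<Longrightarrow> \<forall>x\<in>F. g x = f x \<Longrightarrow> g \<notin> N r"
    proof (cases "f0 \<in> N r")
      case False
      then have "\<not> PI (graph_on f0 A \<union> r)" using f0(2) by (simp add: N_def)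
      then obtain Z where Z: "finite Z" "Z \<subseteq> graph_on f0 A \<union> r" "\<not> PI Z"
        using partial_iso_finite_character[of "graph_on f0 A \<union> r" L M M] by metis
      \<comment> \<open>A map agreeing with \<open>f0\<close> on the domain of the obstruction
        \<open>Z\<close> inside \<open>A\<close> inherits that obstruction.\<close>
      let ?F = "F0 \<union> (Domain Z \<inter> A)"
      show thesis
      proof (rule that)
        fix g assume g: "\<forall>x\<in>?F. g x = f0 x"
        have "Z \<subseteq> graph_on g A \<union> r"
        proof (rule subrelI)
          fix x y assume xy: "(x, y) \<in> Z"
          then have "g x = f0 x" if "x \<in> A"
            using that by (intro bspec[OF g]) blast
          moreover have "(x, y) \<in> r \<or> x \<in> A \<and> y = f0 x" using Z(2) xy by auto
          ultimately show "(x, y) \<in> graph_on g A \<union> r" using g by auto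
        qed
        then show "g \<notin> N r"
          using Z(3) partial_iso_subset[of L M M "graph_on g A \<union> r" Z] by (auto simp: N_def)
      qed (use f0 F0 Z(1) in \<open>auto simp: finite_Domain\<close>)
    next
      case True
      \<comment> \<open>The finite part of \<open>f0\<close> together with \<open>r\<close> is
        broken by some \<open>T\<close>. Off \<open>C\<close>, \<open>T\<close> is a finite partial
        isomorphism from \<open>A\<close> to \<open>B\<close>, so it extends to an isomorphism
        \<open>f\<close>; together with \<open>r\<close>, \<open>f\<close> contains
        \<open>T\<close>.\<close>
      define R where "R = graph_on f0 F0 \<union> r"
      have "R \<subseteq> graph_on f0 A \<union> r" using F0(2) by (auto simp: R_def)
      then have "PI R"
        using True partial_iso_subset[of L M M "graph_on f0 A \<union> r" R] by (simp add: N_def)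
      moreover have "finite R" "C \<subseteq> Domain R" using r F0(1) by (auto simp: R_def)
      ultimately obtain T where T: "R \<subseteq> T" "finite T" "\<not> PI T" "PI (T - C \<times> UNIV)"
        "T - R \<subseteq> A \<times> B" using break by blast
      have f0_AB: "graph_on f0 F0 \<subseteq> A \<times> B"
        using f0(2) F0(2) by (auto simp: Iso_substr_iff)
      have T_AB: "T - C \<times> UNIV \<subseteq> A \<times> B"
      proof (rule subrelI)
        fix x y assume xy: "(x, y) \<in> T - C \<times> UNIV"
        then have "(x, y) \<notin> r" using r(2) by blast
        then show "(x, y) \<in> A \<times> B"
          using xy T(5) f0_AB unfolding R_def by (cases "(x, y) \<in> graph_on f0 F0") blast+
      qed
      then obtain f where f: "f \<in> ?I" "T - C \<times> UNIV \<subseteq> graph_on f A"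
        using generic_Iso_extends[OF A B _ T(4)] T(2) by blast
      have f_T: "f x = y" if "(x, y) \<in> T - C \<times> UNIV" for x y
        using f(2) that by auto
      let ?F = "Domain (T - C \<times> UNIV)"
      have F0_T: "(x, f0 x) \<in> T - C \<times> UNIV" if "x \<in> F0" for x
        using that T(1) F0(2) C(2) by (auto simp: R_def)
      show thesis
      proof (rule that)
        show "f \<in> ?I" by (rule f(1))
        show "\<forall>x\<in>F0. f x = f0 x" using F0_T f_T by blast
        show "finite ?F" using T(2) by (simp add: finite_Domain)
        show "F0 \<subseteq> ?F" using F0_T by blast
        show "?F \<subseteq> A" using T_AB by blast
        fix g assume g: "\<forall>x\<in>?F. g x = f x"
        have "T \<subseteq> graph_on g A \<union> r"
        proof (rule subrelI)
          fix x y assume xy: "(x, y) \<in> T"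
          show "(x, y) \<in> graph_on g A \<union> r"
          proof (cases "x \<in> C")
            case True
            \<comment> \<open>New pairs of \<open>T\<close> start in \<open>A\<close>, so over
              \<open>C\<close> there are only pairs of \<open>r\<close>.\<close>
            then have "(x, y) \<in> R" using xy T(5) C(2) by blast
            moreover have "(x, y) \<notin> graph_on f0 F0" using True C(2) F0(2) by auto
            ultimately show ?thesis by (auto simp: R_def)
          next
            case False
            then have "(x, y) \<in> T - C \<times> UNIV" using xy by simp
            then have "x \<in> A" "g x = y" using T_AB f_T g by blast+
            then show ?thesis by simp
          qed
        qed
        then show "g \<notin> N r"
          using T(3) partial_iso_subset[of L M M "graph_on g A \<union> r" T] by (auto simp: N_def)
      qed
    qed
    let ?V = "{g \<in> ?I. \<forall>x\<in>F. g x = f x}"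
    have "openin ?X ?V"
      using F(1,3) by (auto simp: openin_Iso_space_iff intro!: exI[of _ F])
    moreover have "?V \<noteq> {}" using f(1) by blast
    moreover have "?V \<subseteq> U"
    proof
      fix g assume g: "g \<in> ?V"
      then have "\<forall>x\<in>F0. g x = f0 x" using f(2) F(2) by auto
      with g show "g \<in> U" using F0(3) by simp
    qed
    moreover have "?V \<inter> N r = {}" using avoid by blast
    ultimately show "\<exists>V. openin ?X V \<and> V \<noteq> {} \<and> V \<subseteq> U \<and> V \<inter> N r = {}" by blast
  qed
  let ?R = "{r :: (nat \<times> nat) set. finite r \<and> Domain r = C}"
  have "countable ?R"
    by (rule countable_subset[OF _ countable_Collect_finite]) auto
  then have "meager_in ?X (\<Union>(N ` ?R))"
    unfolding meager_in_def using nowhere_dense by (intro exI[of _ "N ` ?R"]) auto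
  \<comment> \<open>For an extendable \<open>f\<close>, the witness \<open>r\<close> is the
    restriction to \<open>C\<close> of an automorphism extending \<open>f\<close>.\<close>
  moreover have "extendable_isos L M A B \<subseteq> \<Union>(N ` ?R)"
  proof
    fix f assume "f \<in> extendable_isos L M A B"
    then obtain g where f: "f \<in> ?I" and g: "g \<in> Aut L M" "\<forall>x\<in>A. g x = f x"
      by (auto simp: extendable_isos_def)
    have "PI (graph_on g UNIV)"
      using g(1) by (simp add: Aut_def Iso_def self_isomorphism_iff)
    moreover have "graph_on f A \<union> graph_on g C \<subseteq> graph_on g UNIV"
      using g(2) by auto
    ultimately have "PI (graph_on f A \<union> graph_on g C)"
      by (rule partial_iso_subset)
    then have "f \<in> N (graph_on g C)"
      using f by (simp add: N_def)
    moreover have "graph_on g C \<in> ?R" using C(1) by simp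
    ultimately show "f \<in> \<Union>(N ` ?R)" by blast
  qed
  ultimately show ?thesis
    unfolding strongly_nonglobal_pair_def by (rule meager_in_subset)
qed

section \<open>Comeagerness of generic sets and the dichotomy\<close>

text \<open>Genericity fails at \<open>D\<close> and \<open>x\<close> if the orbit lies inside
  \<open>A\<close> or misses it, which \<open>b\<close> records. There are countably many such
  triples, and each gives a nowhere dense set since the orbit is infinite.\<close>

lemma comeager_generic: "comeager_in cantor_space {A. generic A}"
proof -
  define S where "S D x b = {A. \<forall>n\<in>orbit_over D x. n \<in> A \<longleftrightarrow> b}" for D x b
  define J :: "(nat set \<times> nat \<times> bool) set" where "J = {(D, x, b). finite D \<and> x \<notin> D}"
  define \<N> where "\<N> = (\<lambda>(D, x, b). S D x b) ` J"
  have mem: "N \<in> \<N> \<longleftrightarrow> (\<exists>D x b. finite D \<and> x \<notin> D \<and> N = S D x b)" for N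
    by (auto simp: \<N>_def J_def)
  have "A \<in> \<Union>\<N> \<longleftrightarrow> \<not> generic A" for A
  proof -
    have S: "A \<in> S D x True \<longleftrightarrow> orbit_over D x - A = {}"
      "A \<in> S D x False \<longleftrightarrow> orbit_over D x \<inter> A = {}" for D x
      unfolding S_def by blast+
    have "A \<in> \<Union>\<N> \<longleftrightarrow> (\<exists>D x b. finite D \<and> x \<notin> D \<and> A \<in> S D x b)"
      unfolding Union_iff Bex_def mem by blast
    then show ?thesis by (auto simp: generic_def ex_bool_eq S)
  qed
  then have "topspace cantor_space - {A. generic A} = \<Union>\<N>" by auto
  moreover have "countable \<N>"
  proof -
    have "J \<subseteq> Collect finite \<times> UNIV \<times> UNIV" by (auto simp: J_def)
    then have "countable J"
      by (rule countable_subset) (intro countable_SIGMA countable_Collect_finite; simp)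
    then show ?thesis by (simp add: \<N>_def)
  qed
  moreover have "\<forall>N\<in>\<N>. nowhere_dense_in cantor_space N"
    using nowhere_dense_in_cantor_space[OF infinite_orbit_over] by (auto simp: mem S_def)
  ultimately show ?thesis
    unfolding comeager_in_def meager_in_def by auto
qed

text \<open>A single substructure is the pair of \<open>A\<close> with itself, so one fact on
  generic pairs gives both claims.\<close>

lemma comeager_generic_substr:
  assumes "\<And>A B. generic A \<Longrightarrow> generic B \<Longrightarrow> Q A B"
  shows "comeager_in cantor_space {A. Q A A}"
    and "comeager_in (prod_topology cantor_space cantor_space) {(A, B). Q A B}"
proof -
  show "comeager_in cantor_space {A. Q A A}"
    using comeager_generic by (rule comeager_in_superset) (use assms in auto)
  show "comeager_in (prod_topology cantor_space cantor_space) {(A, B). Q A B}"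
    using comeager_in_Times[OF comeager_generic comeager_generic]
    by (rule comeager_in_superset) (use assms in auto)
qed

end

theorem theorem2p19:
  fixes L :: "'r lang" and M :: "('r, nat) struct"
  assumes "fraisse_structure L M" and "carr M = UNIV" and "no_algebraicity L M"
  shows "(splits L (Age L M) \<longrightarrow>
            comeager_in cantor_space {A. strongly_nonglobal_substr L M A} \<and>
            comeager_in (prod_topology cantor_space cantor_space)
              {(A, B). strongly_nonglobal_pair L M A B})
       \<and> (\<not> splits L (Age L M) \<longrightarrow>
            comeager_in cantor_space {A. global_substr L M A} \<and>
            comeager_in (prod_topology cantor_space cantor_space)
              {(A, B). global_pair L M A B})"
proof -
  interpret fraisse_no_algebraicity L M
    using assms by unfold_locales
  show ?thesis
    unfolding strongly_nonglobal_substr_def global_substr_def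
    using comeager_generic_substr[of "strongly_nonglobal_pair L M"]
      comeager_generic_substr[of "global_pair L M"]
      splits_strongly_nonglobal not_splits_global by blast
qed

end
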